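(* There is an absolute constant $C>0$ such that the following holds. Let $\delta,\varepsilon>0$, let $f:\mathbb{R}^n\to\{0,1\}$ be a polynomial threshold function of degree $d$, and let $\lambda\in(0,1)$ satisfy $\lambda\leq C\frac{\delta^2}{d^6\log(1/\varepsilon)}$. Then with probability at least $1-\delta$ over $x\sim N(0,1)^n$, there exists $b\in\{0,1\}$ such that $$\Pr_{y\sim N(0,1)^n}\big[f_{x,\lambda}(y)=b\big]>1-\varepsilon .$$
   Context: $\mathsf{sign}:\mathbb{R}\to\{0,1\}$ is defined by $\mathsf{sign}(z)=1$ if $z\geq0$ and $0$ otherwise. A degree-$d$ polynomial threshold function is $f(x)=\mathsf{sign}(p(x))$ where $p:\mathbb{R}^n\to\mathbb{R}$ is a real polynomial of degree at most $d$. For a function $f:\mathbb{R}^n\to\mathbb{R}$, a point $x\in\mathbb{R}^n$ and $\lambda\in(0,1)$, the gaussian restriction is $f_{x,\lambda}(y):=f(\sqrt{1-\lambda}\,x+\sqrt{\lambda}\,y)$. $N(0,1)^n$ denotes the standard $n$-dimensional gaussian distribution. *)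

theory Defs
  imports "HOL-Probability.Probability"
begin

text \<open>
  The dimension is a natural number rather than a type, because the constant of the theorem has to
  be chosen before the dimension. A point of n-dimensional real space is an extensional function on
  \<open>{..<n}\<close>, matching the space of the product measure below.
\<close>

abbreviation Rn :: "nat \<Rightarrow> (nat \<Rightarrow> real) set" where
  "Rn n \<equiv> {..<n} \<rightarrow>\<^sub>E UNIV"

definition multi_exponents :: "nat \<Rightarrow> nat \<Rightarrow> (nat \<Rightarrow> nat) set" where
  "multi_exponents n d = {\<alpha> \<in> {..<n} \<rightarrow>\<^sub>E UNIV. (\<Sum>i<n. \<alpha> i) \<le> d}"

text \<open>Finiteness matters: the sum in the next definition would otherwise be 0 by convention.\<close>

lemma finite_multi_exponents: "finite (multi_exponents n d)"
proof (rule finite_subset)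
  show "multi_exponents n d \<subseteq> {..<n} \<rightarrow>\<^sub>E {..d}"
  proof
    fix \<alpha> assume a: "\<alpha> \<in> multi_exponents n d"
    have "\<alpha> i \<le> d" if "i < n" for i
    proof -
      have "\<alpha> i \<le> (\<Sum>i<n. \<alpha> i)"
        using that by (intro member_le_sum) auto
      with a show ?thesis by (simp add: multi_exponents_def)
    qed
    with a show "\<alpha> \<in> {..<n} \<rightarrow>\<^sub>E {..d}"
      by (auto simp: multi_exponents_def PiE_iff)
  qed
qed (intro finite_PiE; simp)

definition polynomial_of_degree_le :: "nat \<Rightarrow> nat \<Rightarrow> ((nat \<Rightarrow> real) \<Rightarrow> real) \<Rightarrow> bool" where
  "polynomial_of_degree_le n d p \<longleftrightarrow>
     (\<exists>c :: (nat \<Rightarrow> nat) \<Rightarrow> real. \<forall>x \<in> Rn n.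
        p x = (\<Sum>\<alpha>\<in>multi_exponents n d. c \<alpha> * (\<Prod>i<n. x i ^ \<alpha> i)))"

text \<open>Unlike the library's \<open>sgn\<close>, this takes values in \<open>{0, 1}\<close>, with value 1 at 0.\<close>

definition sign01 :: "real \<Rightarrow> real" where
  "sign01 z = (if z \<ge> 0 then 1 else 0)"

definition polynomial_threshold_function ::
    "nat \<Rightarrow> nat \<Rightarrow> ((nat \<Rightarrow> real) \<Rightarrow> real) \<Rightarrow> bool" where
  "polynomial_threshold_function n d f \<longleftrightarrow>
     (\<exists>p. polynomial_of_degree_le n d p \<and> (\<forall>x \<in> Rn n. f x = sign01 (p x)))"

definition gaussian_restriction ::
    "nat \<Rightarrow> ((nat \<Rightarrow> real) \<Rightarrow> real) \<Rightarrow> (nat \<Rightarrow> real) \<Rightarrow> real \<Rightarrow> (nat \<Rightarrow> real) \<Rightarrow> real" where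
  "gaussian_restriction n f x lam y =
     f (\<lambda>i\<in>{..<n}. sqrt (1 - lam) * x i + sqrt lam * y i)"

definition std_gaussian :: "nat \<Rightarrow> (nat \<Rightarrow> real) measure" where
  "std_gaussian n = (\<Pi>\<^sub>M i\<in>{..<n}. std_normal_distribution)"

lemma space_std_gaussian: "space (std_gaussian n) = Rn n"
  by (simp add: std_gaussian_def space_PiM)

lemma prob_space_std_gaussian: "prob_space (std_gaussian n)"
  unfolding std_gaussian_def by (intro prob_space_PiM prob_space_normal_density) simp

end

theory Submission
  imports Defs "HOL-Computational_Algebra.Fundamental_Theorem_Algebra"
begin

text \<open>
  Let \<open>p\<close> have degree \<open>d\<close>. For independent Gaussian \<open>x\<close> and \<open>y\<close>, the derivative of \<open>p\<close> at \<open>x\<close> in direction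
  \<open>y\<close> exceeds \<open>M * \<bar>p x\<bar>\<close> only with probability \<open>O(d^2/M)\<close> (Kane): rotating the pair \<open>(x, y)\<close> preserves
  its law and turns \<open>p\<close> into a univariate rational function of the rotation parameter, whose logarithmic
  derivative is large only near the real parts of its \<open>O(d)\<close> complex roots. Testing a vector of
  polynomials against an independent Gaussian vector, this says that the Euclidean norm of the
  tensor of order \<open>k + 1\<close> of derivatives of \<open>p\<close> is at most \<open>M\<close> times that of order \<open>k\<close>, for all
  \<open>k < d\<close>, outside a set of Gaussian measure \<open>O(d^3/M)\<close>. By Taylor's formula the sign of \<open>p\<close> is constant on
  a ball of radius of order \<open>1/M\<close> about every point outside this exceptional set. With \<open>M\<close> of order
  \<open>d^3/\<delta>\<close>, for all \<open>x\<close> outside a set of measure \<open>\<delta>\<close> at least half of all \<open>y\<close> give a point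
  \<open>sqrt (1 - lam) * x + sqrt lam * y\<close> of this kind, so that one sign is taken in this stable way with
  probability at least 1/4. Gaussian concentration extends it to all \<open>y\<close> within a distance of order
  \<open>sqrt (ln (1/\<epsilon>))\<close>, hence to all but a fraction \<open>\<epsilon>\<close>.
\<close>

section \<open>Logarithmic derivatives of polynomials and planar rotations\<close>

text \<open>The quotient \<open>p'/p\<close> is the sum of \<open>1 / (x - z)\<close> over the roots
  \<open>z\<close> with multiplicity, and each summand has modulus at most \<open>1 / r\<close> when
  every root is at distance at least \<open>r\<close>. The multiplicative form also covers
  \<open>p = 0\<close>.\<close>

lemma poly_log_derivative_bound:
  fixes p :: "complex poly"
  assumes "0 < r"
  shows "\<exists>S. finite S \<and> card S \<le> degree p \<and>
    (\<forall>x. (\<forall>z\<in>S. r \<le> cmod (x - z)) \<longrightarrow>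
      cmod (poly (pderiv p) x) \<le> degree p / r * cmod (poly p x))"
proof -
  obtain root where root: "smult (lead_coeff p) (\<Prod>i<degree p. [:-root i, 1:]) = p"
    using complex_poly_decompose' .
  have *: "\<forall>x. (\<forall>z\<in>root ` {..<n}. r \<le> cmod (x - z)) \<longrightarrow>
      cmod (poly (pderiv (\<Prod>i<n. [:-root i, 1:])) x)
        \<le> n / r * cmod (poly (\<Prod>i<n. [:-root i, 1:]) x)" for n
  proof (induction n)
    case (Suc n)
    show ?case
    proof (intro allI impI)
      fix x assume far: "\<forall>z\<in>root ` {..<Suc n}. r \<le> cmod (x - z)"
      let ?P = "\<Prod>i<n. [:-root i, 1:]"
      have "poly (pderiv (?P * [:-root n, 1:])) x = poly ?P x + (x - root n) * poly (pderiv ?P) x"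
        unfolding pderiv_mult by (simp add: pderiv_pCons) (simp add: left_diff_distrib)
      then have "cmod (poly (pderiv (\<Prod>i<Suc n. [:-root i, 1:])) x)
          = cmod (poly ?P x + (x - root n) * poly (pderiv ?P) x)"
        by (simp only: prod.lessThan_Suc)
      also have "\<dots> \<le> cmod (poly ?P x) + cmod (x - root n) * cmod (poly (pderiv ?P) x)"
        using norm_triangle_ineq[of "poly ?P x" "(x - root n) * poly (pderiv ?P) x"]
        by (simp only: norm_mult)
      \<comment> \<open>The factor \<open>cmod (x - root n) / r\<close> is at least 1, so the new
        root contributes one more \<open>1 / r\<close> relative to the longer product.\<close>
      also have "\<dots> \<le> cmod (x - root n) / r * cmod (poly ?P x)
          + cmod (x - root n) * (n / r * cmod (poly ?P x))"
      proof (intro add_mono mult_left_mono)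
        show "cmod (poly ?P x) \<le> cmod (x - root n) / r * cmod (poly ?P x)"
          using far assms mult_right_mono[of 1 "cmod (x - root n) / r" "cmod (poly ?P x)"] by simp
      qed (use Suc far in auto)
      also have "\<dots> = Suc n / r * cmod (poly (\<Prod>i<Suc n. [:-root i, 1:]) x)"
      proof -
        have "cmod (poly (\<Prod>i<Suc n. [:-root i, 1:]) x) = cmod (poly ?P x) * cmod (poly [:-root n, 1:] x)"
          by (simp only: prod.lessThan_Suc poly_mult norm_mult)
        also have "poly [:-root n, 1:] x = x - root n" by simp
        finally show ?thesis by (simp add: add_divide_distrib algebra_simps del: poly_prod)
      qed
      finally show "cmod (poly (pderiv (\<Prod>i<Suc n. [:-root i, 1:])) x)
          \<le> Suc n / r * cmod (poly (\<Prod>i<Suc n. [:-root i, 1:]) x)" .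
    qed
  qed (simp add: pderiv_1)
  show ?thesis
  proof (intro exI[of _ "root ` {..<degree p}"] conjI allI impI)
    show "card (root ` {..<degree p}) \<le> degree p"
      using card_image_le[of "{..<degree p}" root] by simp
    fix x assume far: "\<forall>z\<in>root ` {..<degree p}. r \<le> cmod (x - z)"
    let ?P = "\<Prod>i<degree p. [:-root i, 1:]"
    have "cmod (poly (pderiv p) x) = cmod (lead_coeff p) * cmod (poly (pderiv ?P) x)"
      by (subst root[symmetric]) (simp only: pderiv_smult poly_smult norm_mult)
    also have "\<dots> \<le> cmod (lead_coeff p) * (degree p / r * cmod (poly ?P x))"
      using * far by (intro mult_left_mono) auto
    also have "\<dots> = degree p / r * cmod (lead_coeff p * poly ?P x)"
      by (simp only: norm_mult) (simp add: algebra_simps)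
    also have "lead_coeff p * poly ?P x = poly p x"
      by (subst (3) root[symmetric]) simp
    finally show "cmod (poly (pderiv p) x) \<le> degree p / r * cmod (poly p x)" .
  qed simp
qed

text \<open>A real \<open>t\<close> within \<open>r\<close> of a complex root \<open>z\<close> lies
  within \<open>r\<close> of \<open>Re z\<close>, so the exceptional \<open>t\<close> are covered by
  at most \<open>m\<close> intervals of length \<open>2 * r\<close>.\<close>

lemma emeasure_poly_derivative_large:
  fixes F :: "real poly"
  assumes "0 < r" "degree F \<le> m"
  shows "emeasure lborel {t \<in> {0..1}. m / r * \<bar>poly F t\<bar> < \<bar>poly (pderiv F) t\<bar>}
    \<le> ennreal (2 * m * r)"
proof -
  let ?F = "map_poly complex_of_real F"
  have deg: "degree ?F = degree F" by (simp add: degree_map_poly)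
  have poly: "poly (map_poly complex_of_real G) (of_real t) = of_real (poly G t)" for G t
    by (induction G) (auto simp: map_poly_pCons)
  have pderiv: "pderiv ?F = map_poly complex_of_real (pderiv F)"
    by (intro poly_eqI) (simp add: coeff_pderiv coeff_map_poly)
  obtain S where S: "finite S" "card S \<le> degree F"
    "\<And>x. (\<forall>z\<in>S. r \<le> cmod (x - z)) \<Longrightarrow>
      cmod (poly (pderiv ?F) x) \<le> degree F / r * cmod (poly ?F x)"
    using poly_log_derivative_bound[OF assms(1), of ?F] deg by auto
  have sub: "{t \<in> {0..1}. m / r * \<bar>poly F t\<bar> < \<bar>poly (pderiv F) t\<bar>}
    \<subseteq> (\<Union>z\<in>S. {Re z - r..Re z + r})"
  proof
    fix t assume t: "t \<in> {t \<in> {0..1}. m / r * \<bar>poly F t\<bar> < \<bar>poly (pderiv F) t\<bar>}"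
    have "\<exists>z\<in>S. cmod (t - z) < r"
    proof (rule ccontr)
      assume "\<not> (\<exists>z\<in>S. cmod (t - z) < r)"
      then have "cmod (poly (pderiv ?F) t) \<le> degree F / r * cmod (poly ?F t)"
        by (intro S(3)) force
      then have "\<bar>poly (pderiv F) t\<bar> \<le> degree F / r * \<bar>poly F t\<bar>"
        by (simp add: pderiv poly)
      also have "\<dots> \<le> m / r * \<bar>poly F t\<bar>"
        using assms by (intro mult_right_mono divide_right_mono) auto
      finally show False using t by simp
    qed
    then obtain z :: complex where "z \<in> S" "cmod (t - z) < r" by blast
    moreover have "\<bar>t - Re z\<bar> \<le> cmod (t - z)"
      using abs_Re_le_cmod[of "t - z"] by simp
    ultimately have "t \<in> {Re z - r..Re z + r}" unfolding atLeastAtMost_iff by linarith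
    with \<open>z \<in> S\<close> show "t \<in> (\<Union>z\<in>S. {Re z - r..Re z + r})" by (rule UN_I)
  qed
  have "emeasure lborel {t \<in> {0..1}. m / r * \<bar>poly F t\<bar> < \<bar>poly (pderiv F) t\<bar>}
      \<le> emeasure lborel (\<Union>z\<in>S. {Re z - r..Re z + r})"
    by (intro emeasure_mono sub sets.finite_UN S) auto
  also have "\<dots> \<le> (\<Sum>z\<in>S. emeasure lborel {Re z - r..Re z + r})"
    by (intro emeasure_subadditive_finite S) auto
  also have "\<dots> = ennreal (card S * (2 * r))"
    using assms by (simp add: ennreal_mult ennreal_of_nat_eq_real_of_nat)
  also have "\<dots> \<le> ennreal (2 * real m * r)"
    using S(2) assms by (intro ennreal_leI) (auto simp: field_simps)
  finally show ?thesis .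
qed

section \<open>Rotation invariance of the planar Gaussian measure\<close>

lemma nn_integral_lborel_shear:
  assumes [measurable]: "L \<in> borel_measurable (borel \<Otimes>\<^sub>M borel)"
  shows "(\<integral>\<^sup>+b. \<integral>\<^sup>+a. L (a + t * b, b) \<partial>lborel \<partial>lborel) = (\<integral>\<^sup>+b. \<integral>\<^sup>+a. L (a, b::real) \<partial>lborel \<partial>lborel)"
proof (rule nn_integral_cong)
  fix b :: real
  show "(\<integral>\<^sup>+a. L (a + t * b, b) \<partial>lborel) = (\<integral>\<^sup>+a. L (a, b) \<partial>lborel)"
    by (subst (2) nn_integral_real_affine[of _ 1 "t * b"]) (auto simp: add.commute)
qed

lemma nn_integral_lborel_swap:
  assumes [measurable]: "L \<in> borel_measurable (borel \<Otimes>\<^sub>M borel)"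
  shows "(\<integral>\<^sup>+b. \<integral>\<^sup>+a. L (a, b::real) \<partial>lborel \<partial>lborel) = (\<integral>\<^sup>+a. \<integral>\<^sup>+b. L (a, b::real) \<partial>lborel \<partial>lborel)"
  by (rule lborel_pair.Fubini') simp

text \<open>A rotation is a product of three shears.\<close>

lemma nn_integral_lborel_rotate:
  assumes L [measurable]: "L \<in> borel_measurable (borel \<Otimes>\<^sub>M borel)"
    and cs: "c\<^sup>2 + s\<^sup>2 = 1" "c \<noteq> -1"
  shows "(\<integral>\<^sup>+a. \<integral>\<^sup>+b. L (c * a + s * b, - s * a + c * b) \<partial>lborel \<partial>lborel)
    = (\<integral>\<^sup>+a. \<integral>\<^sup>+b. L (a, b::real) \<partial>lborel \<partial>lborel)"
proof -
  \<comment> \<open>For \<open>c\<close> and \<open>s\<close> the cosine and sine of an angle,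
    \<open>t\<close> is the tangent of half of it, the parameter of the two outer shears; it exists
    because \<open>c \<noteq> -1\<close>.\<close>
  define t where "t = s / (1 + c)"
  have t: "t * (1 + c) = s" using cs(2) by (simp add: t_def add_eq_0_iff)
  have "(1 + c) * (1 - t * s) = 1 + c - (t * (1 + c)) * s" by (simp add: algebra_simps)
  also have "\<dots> = 1 + c - s\<^sup>2" by (simp add: t power2_eq_square)
  also have "\<dots> = (1 + c) * c" using cs(1) by algebra
  finally have c: "1 - t * s = c" using cs(2) by (simp add: add_eq_0_iff)
  have eq: "L (c * a + s * b, - s * a + c * b)
      = L ((a + t * b) + t * (b - s * (a + t * b)), b - s * (a + t * b))" for a b
  proof -
    have "(a + t * b) + t * (b - s * (a + t * b)) = (1 - t * s) * a + (t + t * (1 - t * s)) * b"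
      by (simp add: algebra_simps)
    also have "\<dots> = c * a + s * b" unfolding c using t by (simp add: algebra_simps)
    finally have "(a + t * b) + t * (b - s * (a + t * b)) = c * a + s * b" .
    moreover have "b - s * (a + t * b) = - s * a + (1 - t * s) * b" by (simp add: algebra_simps)
    ultimately show ?thesis by (simp only: c)
  qed
  have "(\<integral>\<^sup>+a. \<integral>\<^sup>+b. L (c * a + s * b, - s * a + c * b) \<partial>lborel \<partial>lborel)
    = (\<integral>\<^sup>+b. \<integral>\<^sup>+a. L ((a + t * b) + t * (b - s * (a + t * b)), b - s * (a + t * b)) \<partial>lborel \<partial>lborel)"
    unfolding eq using nn_integral_lborel_swap[of
        "\<lambda>(a, b). L ((a + t * b) + t * (b - s * (a + t * b)), b - s * (a + t * b))"] by simp
  also have "\<dots> = (\<integral>\<^sup>+b. \<integral>\<^sup>+a. L (a + t * (b - s * a), b - s * a) \<partial>lborel \<partial>lborel)"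
    using nn_integral_lborel_shear[of "\<lambda>(a, b). L (a + t * (b - s * a), b - s * a)" t] by simp
  also have "\<dots> = (\<integral>\<^sup>+a. \<integral>\<^sup>+b. L (a + t * (b - s * a), b - s * a) \<partial>lborel \<partial>lborel)"
    using nn_integral_lborel_swap[of "\<lambda>(a, b). L (a + t * (b - s * a), b - s * a)"] by simp
  also have "\<dots> = (\<integral>\<^sup>+a. \<integral>\<^sup>+b. L (a + t * b, b) \<partial>lborel \<partial>lborel)"
    using nn_integral_lborel_shear[of "\<lambda>(b, a). L (a + t * b, b)" "- s"] by simp
  also have "\<dots> = (\<integral>\<^sup>+b. \<integral>\<^sup>+a. L (a + t * b, b) \<partial>lborel \<partial>lborel)"
    using nn_integral_lborel_swap[of "\<lambda>(a, b). L (a + t * b, b)"] by simp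
  also have "\<dots> = (\<integral>\<^sup>+b. \<integral>\<^sup>+a. L (a, b) \<partial>lborel \<partial>lborel)"
    by (rule nn_integral_lborel_shear) simp
  also have "\<dots> = (\<integral>\<^sup>+a. \<integral>\<^sup>+b. L (a, b) \<partial>lborel \<partial>lborel)"
    by (rule nn_integral_lborel_swap) simp
  finally show ?thesis .
qed

lemma std_normal_density_mult_rotate:
  assumes "c\<^sup>2 + s\<^sup>2 = 1"
  shows "std_normal_density (c * a + s * b) * std_normal_density (- s * a + c * b)
    = std_normal_density a * std_normal_density b"
proof -
  have "(c * a + s * b)\<^sup>2 + (- s * a + c * b)\<^sup>2 = (c\<^sup>2 + s\<^sup>2) * (a\<^sup>2 + b\<^sup>2)" by algebra
  then have "(c * a + s * b)\<^sup>2 + (- s * a + c * b)\<^sup>2 = a\<^sup>2 + b\<^sup>2" using assms by simp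
  then show ?thesis
    by (simp add: std_normal_density_def flip: exp_add add_divide_distrib minus_add_distrib)
qed

lemma nn_integral_normal_rotate:
  assumes [measurable]: "L \<in> borel_measurable (borel \<Otimes>\<^sub>M borel)"
    and cs: "c\<^sup>2 + s\<^sup>2 = 1" "c \<noteq> -1"
  shows "(\<integral>\<^sup>+a. \<integral>\<^sup>+b. L (c * a + s * b, - s * a + c * b) \<partial>std_normal_distribution \<partial>std_normal_distribution)
    = (\<integral>\<^sup>+a. \<integral>\<^sup>+b. L (a, b::real) \<partial>std_normal_distribution \<partial>std_normal_distribution)"
proof -
  let ?\<phi> = "\<lambda>a b. ennreal (std_normal_density a * std_normal_density b)"
  have D: "(\<integral>\<^sup>+a. \<integral>\<^sup>+b. K (a, b) \<partial>std_normal_distribution \<partial>std_normal_distribution)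
    = (\<integral>\<^sup>+a. \<integral>\<^sup>+b. ?\<phi> a b * K (a, b) \<partial>lborel \<partial>lborel)"
    if [measurable]: "K \<in> borel_measurable (borel \<Otimes>\<^sub>M borel)" for K
    by (simp add: nn_integral_density ennreal_mult mult.assoc nn_integral_cmult)
  have "(\<integral>\<^sup>+a. \<integral>\<^sup>+b. L (c * a + s * b, - s * a + c * b) \<partial>std_normal_distribution \<partial>std_normal_distribution)
      = (\<integral>\<^sup>+a. \<integral>\<^sup>+b. ?\<phi> a b * L (c * a + s * b, - s * a + c * b) \<partial>lborel \<partial>lborel)"
    using D[of "\<lambda>(a, b). L (c * a + s * b, - s * a + c * b)"] by simp
  also have "\<dots> = (\<integral>\<^sup>+a. \<integral>\<^sup>+b. ?\<phi> (c * a + s * b) (- s * a + c * b)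
      * L (c * a + s * b, - s * a + c * b) \<partial>lborel \<partial>lborel)"
    by (simp only: std_normal_density_mult_rotate[OF cs(1)])
  also have "\<dots> = (\<integral>\<^sup>+a. \<integral>\<^sup>+b. ?\<phi> a b * L (a, b) \<partial>lborel \<partial>lborel)"
    using nn_integral_lborel_rotate[of "\<lambda>(a, b). ?\<phi> a b * L (a, b)", OF _ cs] by simp
  also have "\<dots> = (\<integral>\<^sup>+a. \<integral>\<^sup>+b. L (a, b) \<partial>std_normal_distribution \<partial>std_normal_distribution)"
    by (rule D[symmetric]) simp
  finally show ?thesis .
qed

section \<open>Gaussian concentration\<close>

text \<open>Fubini for the region below the graph of \<open>u / s\<close>. The level is
  \<open>\<tau> * s\<close>, so that functions with different suprema can be compared at the same
  \<open>\<tau>\<close>.\<close>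

lemma nn_integral_layer_cake:
  fixes u :: "real \<Rightarrow> real"
  assumes [measurable]: "u \<in> borel_measurable borel" and "0 < s" and u: "\<And>a. 0 \<le> u a"
  shows "(\<integral>\<^sup>+\<tau>. emeasure lborel {a. \<tau> * s < u a} * indicator {0<..} \<tau> \<partial>lborel)
    = (\<integral>\<^sup>+a. ennreal (u a / s) \<partial>lborel)"
proof -
  have "(\<integral>\<^sup>+\<tau>. emeasure lborel {a. \<tau> * s < u a} * indicator {0<..} \<tau> \<partial>lborel)
      = (\<integral>\<^sup>+\<tau>. \<integral>\<^sup>+a. indicator {0<..<u a / s} \<tau> \<partial>lborel \<partial>lborel)"
  proof (intro nn_integral_cong)
    fix \<tau> :: real
    have "emeasure lborel {a. \<tau> * s < u a} * indicator {0<..} \<tau>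
        = (\<integral>\<^sup>+a. indicator {a. \<tau> * s < u a} a * indicator {0<..} \<tau> \<partial>lborel)"
      by (simp add: nn_integral_multc)
    also have "\<dots> = (\<integral>\<^sup>+a. indicator {0<..<u a / s} \<tau> \<partial>lborel)"
      using \<open>0 < s\<close> by (intro nn_integral_cong) (auto simp: indicator_def field_simps)
    finally show "emeasure lborel {a. \<tau> * s < u a} * indicator {0<..} \<tau>
        = (\<integral>\<^sup>+a. indicator {0<..<u a / s} \<tau> \<partial>lborel)" .
  qed
  also have "\<dots> = (\<integral>\<^sup>+a. \<integral>\<^sup>+\<tau>. indicator {0<..<u a / s} \<tau> \<partial>lborel \<partial>lborel)"
  proof (rule lborel_pair.Fubini')
    show "(\<lambda>(x, y). indicator {0<..<u x / s} y) \<in> borel_measurable (lborel \<Otimes>\<^sub>M lborel)"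
      unfolding indicator_def greaterThanLessThan_iff by measurable
  qed
  also have "\<dots> = (\<integral>\<^sup>+a. ennreal (u a / s) \<partial>lborel)"
    using \<open>0 < s\<close> u by (intro nn_integral_cong) (auto simp: zero_le_divide_iff)
  finally show ?thesis .
qed

text \<open>A one-dimensional Brunn--Minkowski inequality. \<open>K\<close> contains the open
  interval from the midpoint of the infima to that of the suprema, whose length is half the sum of
  the lengths of the hulls of \<open>A\<close> and \<open>B\<close>.\<close>

lemma emeasure_midpoints_interval:
  fixes A B K :: "real set"
  assumes [measurable]: "A \<in> sets borel" "B \<in> sets borel" "K \<in> sets borel"
    and ne: "A \<noteq> {}" "B \<noteq> {}" and K: "is_interval K" "bounded K"
    and mid: "\<And>a b. a \<in> A \<Longrightarrow> b \<in> B \<Longrightarrow> (a + b) / 2 \<in> K"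
  shows "emeasure lborel A + emeasure lborel B \<le> 2 * emeasure lborel K"
proof -
  obtain R where R: "\<And>x. x \<in> K \<Longrightarrow> \<bar>x\<bar> \<le> R" using K(2) by (auto simp: bounded_iff)
  obtain a0 b0 where 0: "a0 \<in> A" "b0 \<in> B" using ne by blast
  have "\<bar>a\<bar> \<le> 2 * R + \<bar>b0\<bar>" if "a \<in> A" for a using R[OF mid[OF that 0(2)]] by (simp add: field_simps)
  then have A: "bdd_above A" "bdd_below A"
    by (auto simp: bdd_above_def bdd_below_def) (metis abs_le_iff, metis abs_le_iff minus_le_iff)
  have "\<bar>b\<bar> \<le> 2 * R + \<bar>a0\<bar>" if "b \<in> B" for b using R[OF mid[OF 0(1) that]] by (simp add: field_simps)
  then have B: "bdd_above B" "bdd_below B"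
    by (auto simp: bdd_above_def bdd_below_def) (metis abs_le_iff, metis abs_le_iff minus_le_iff)
  have leA: "Inf A \<le> Sup A" and leB: "Inf B \<le> Sup B"
    using A B ne by (auto intro: cInf_le_cSup)
  have "emeasure lborel A \<le> emeasure lborel {Inf A..Sup A}"
    using A by (intro emeasure_mono) (auto intro: cInf_lower cSup_upper)
  then have eA: "emeasure lborel A \<le> ennreal (Sup A - Inf A)" using leA by simp
  have "emeasure lborel B \<le> emeasure lborel {Inf B..Sup B}"
    using B by (intro emeasure_mono) (auto intro: cInf_lower cSup_upper)
  then have eB: "emeasure lborel B \<le> ennreal (Sup B - Inf B)" using leB by simp
  have sub: "{(Inf A + Inf B) / 2<..<(Sup A + Sup B) / 2} \<subseteq> K"
  proof
    fix x assume x: "x \<in> {(Inf A + Inf B) / 2<..<(Sup A + Sup B) / 2}"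
    define e where "e = x - (Inf A + Inf B) / 2"
    have e: "e > 0" using x by (simp add: e_def)
    obtain a where a: "a \<in> A" "a < Inf A + e" using cInf_lessD[OF ne(1), of "Inf A + e"] e by auto
    obtain b where b: "b \<in> B" "b < Inf B + e" using cInf_lessD[OF ne(2), of "Inf B + e"] e by auto
    have 1: "(a + b) / 2 < x" using a b unfolding e_def by argo
    define e' where "e' = (Sup A + Sup B) / 2 - x"
    have e': "e' > 0" using x by (simp add: e'_def)
    obtain a' where a': "a' \<in> A" "Sup A - e' < a'" using less_cSupD[OF ne(1), of "Sup A - e'"] e' by auto
    obtain b' where b': "b' \<in> B" "Sup B - e' < b'" using less_cSupD[OF ne(2), of "Sup B - e'"] e' by auto
    have 2: "x < (a' + b') / 2" using a' b' unfolding e'_def by argo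
    show "x \<in> K"
      using K(1) mid[OF a(1) b(1)] mid[OF a'(1) b'(1)] 1 2 unfolding is_interval_1 by (meson less_imp_le)
  qed
  have "emeasure lborel A + emeasure lborel B \<le> ennreal (Sup A - Inf A) + ennreal (Sup B - Inf B)"
    by (intro add_mono eA eB)
  also have "\<dots> = 2 * ennreal ((Sup A + Sup B) / 2 - (Inf A + Inf B) / 2)"
  proof -
    have "ennreal (Sup A - Inf A) + ennreal (Sup B - Inf B)
        = ennreal (2 * ((Sup A + Sup B) / 2 - (Inf A + Inf B) / 2))"
      using leA leB by (simp flip: ennreal_plus) (simp add: field_simps)
    then show ?thesis by (subst (asm) ennreal_mult) (use leA leB in auto)
  qed
  also have "\<dots> = 2 * emeasure lborel {(Inf A + Inf B) / 2<..<(Sup A + Sup B) / 2}"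
    using leA leB by simp
  also have "\<dots> \<le> 2 * emeasure lborel K"
    by (intro mult_left_mono emeasure_mono sub) auto
  finally show ?thesis .
qed

lemma std_normal_density_le: "std_normal_density x \<le> 1 / (1 + x\<^sup>2 / 2)"
proof -
  have "std_normal_density x \<le> exp (- x\<^sup>2 / 2)"
    using pi_gt3 by (simp add: std_normal_density_def field_simps real_le_rsqrt)
  also have "\<dots> = 1 / exp (x\<^sup>2 / 2)" by (simp add: exp_minus field_simps)
  also have "\<dots> \<le> 1 / (1 + x\<^sup>2 / 2)"
  proof (rule divide_left_mono)
    show "0 < exp (x\<^sup>2 / 2) * (1 + x\<^sup>2 / 2)"
      by (intro mult_pos_pos add_pos_nonneg) auto
  qed (use exp_ge_add_one_self[of "x\<^sup>2 / 2"] in auto)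
  finally show ?thesis .
qed

lemma std_normal_superlevel:
  assumes "0 < \<kappa>"
  shows "is_interval {x. \<kappa> < std_normal_density x}" "bounded {x. \<kappa> < std_normal_density x}"
proof -
  have mono: "std_normal_density y \<le> std_normal_density x" if "\<bar>x\<bar> \<le> \<bar>y\<bar>" for x y
    using that by (simp add: std_normal_density_def divide_right_mono abs_le_square_iff)
  show "is_interval {x. \<kappa> < std_normal_density x}"
    unfolding is_interval_1
  proof (intro ballI allI impI)
    fix a b x :: real assume *: "a \<in> {x. \<kappa> < std_normal_density x}" "b \<in> {x. \<kappa> < std_normal_density x}"
      "a \<le> x \<and> x \<le> b"
    then have "\<bar>x\<bar> \<le> \<bar>a\<bar> \<or> \<bar>x\<bar> \<le> \<bar>b\<bar>" by linarith
    with * show "x \<in> {x. \<kappa> < std_normal_density x}"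
      using mono[of x a] mono[of x b] by auto
  qed
  show "bounded {x. \<kappa> < std_normal_density x}"
    unfolding bounded_iff
  proof (intro exI ballI)
    fix x assume "x \<in> {x. \<kappa> < std_normal_density x}"
    then have "\<kappa> < 1 / (1 + x\<^sup>2 / 2)" using std_normal_density_le[of x] by simp
    moreover have "0 < 1 + x\<^sup>2 / 2" by (intro add_pos_nonneg) auto
    ultimately have "\<kappa> * (1 + x\<^sup>2 / 2) < 1" by (simp add: pos_less_divide_eq)
    then have "x\<^sup>2 \<le> 2 / \<kappa>" using assms by (simp add: field_simps)
    then show "norm x \<le> sqrt (2 / \<kappa>)" by (metis real_norm_def real_sqrt_abs real_sqrt_le_iff)
  qed
qed

text \<open>Both functions are normalised to have supremum 1, and corresponding superlevel sets are compared:
  the midpoints of two of them lie in a superlevel set of the Gaussian density, which is an interval.\<close>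

lemma prekopa_leindler_normal:
  fixes u v :: "real \<Rightarrow> real"
  assumes [measurable]: "u \<in> borel_measurable borel" "v \<in> borel_measurable borel"
    and nn: "\<And>a. 0 \<le> u a" "\<And>b. 0 \<le> v b" and pos: "0 < u a0" "0 < v b0"
    and uv: "\<And>a b. u a * v b \<le> (std_normal_density ((a + b) / 2))\<^sup>2"
  shows "(\<integral>\<^sup>+a. u a \<partial>lborel) * (\<integral>\<^sup>+b. v b \<partial>lborel) \<le> 1"
proof -
  have le1: "std_normal_density x \<le> 1" for x
    using std_normal_density_le[of x] by (rule order_trans) (simp add: field_simps add_pos_nonneg)
  have uv1: "u a * v b \<le> 1" for a b
    using uv[of a b] le1[of "(a + b) / 2"] power_le_one[of "std_normal_density ((a + b) / 2)" 2] by simp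
  have bu: "bdd_above (range u)"
    using uv1[of _ b0] pos by (intro bdd_aboveI2[where M = "1 / v b0"]) (simp add: field_simps)
  have bv: "bdd_above (range v)"
    using uv1[of a0] pos by (intro bdd_aboveI2[where M = "1 / u a0"]) (simp add: field_simps)
  \<comment> \<open>The geometric mean \<open>c\<close> of the suprema is the level scale for the
    density: \<open>(\<tau> * c)\<^sup>2\<close> equals \<open>(\<tau> * s) * (\<tau> * t)\<close>,
    which matches the hypothesis \<open>uv\<close>.\<close>
  define s t c where "s = (SUP a. u a)" and "t = (SUP b. v b)" and "c = sqrt (s * t)"
  have us: "u a \<le> s" for a unfolding s_def by (rule cSUP_upper[OF _ bu]) simp
  have vt: "v b \<le> t" for b unfolding t_def by (rule cSUP_upper[OF _ bv]) simp
  have s: "0 < s" and t: "0 < t" using us[of a0] vt[of b0] pos by linarith+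
  have c: "0 < c" "c\<^sup>2 = s * t" using s t by (auto simp: c_def)
  let ?U = "\<integral>\<^sup>+a. ennreal (u a / s) \<partial>lborel" and ?V = "\<integral>\<^sup>+b. ennreal (v b / t) \<partial>lborel"
  have "?U + ?V = (\<integral>\<^sup>+\<tau>. emeasure lborel {a. \<tau> * s < u a} * indicator {0<..} \<tau>
      + emeasure lborel {b. \<tau> * t < v b} * indicator {0<..} \<tau> \<partial>lborel)"
    using s t nn by (subst nn_integral_add) (auto simp: nn_integral_layer_cake)
  also have "\<dots> \<le> (\<integral>\<^sup>+\<tau>. 2 * (emeasure lborel {x. \<tau> * c < std_normal_density x} * indicator {0<..} \<tau>) \<partial>lborel)"
  proof (rule nn_integral_mono)
    fix \<tau> :: real
    let ?A = "{a. \<tau> * s < u a}" and ?B = "{b. \<tau> * t < v b}" and ?K = "{x. \<tau> * c < std_normal_density x}"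
    show "emeasure lborel ?A * indicator {0<..} \<tau> + emeasure lborel ?B * indicator {0<..} \<tau>
      \<le> 2 * (emeasure lborel ?K * indicator {0<..} \<tau>)"
    \<comment> \<open>For \<open>\<tau>\<close> strictly between 0 and 1 both superlevel sets are
      nonempty, as the midpoint bound requires; from 1 on both are empty because \<open>s\<close>
      and \<open>t\<close> are upper bounds.\<close>
    proof (cases "0 < \<tau> \<and> \<tau> < 1")
      case True
      have "emeasure lborel ?A + emeasure lborel ?B \<le> 2 * emeasure lborel ?K"
      proof (rule emeasure_midpoints_interval)
        have "\<tau> * s < (SUP a. u a)" using True s by (simp add: s_def)
        then show "?A \<noteq> {}" using less_cSUP_iff[OF _ bu] by auto
        have "\<tau> * t < (SUP b. v b)" using True t by (simp add: t_def)
        then show "?B \<noteq> {}" using less_cSUP_iff[OF _ bv] by auto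
        show "is_interval ?K" "bounded ?K" using True c by (auto intro!: std_normal_superlevel)
        fix a b assume ab: "a \<in> ?A" "b \<in> ?B"
        have "(\<tau> * c)\<^sup>2 = (\<tau> * s) * (\<tau> * t)" by (simp add: power_mult_distrib c) (simp add: power2_eq_square)
        also have "\<dots> < u a * v b"
          using ab True s t by (intro mult_strict_mono) (auto intro: less_trans[OF mult_pos_pos])
        also have "\<dots> \<le> (std_normal_density ((a + b) / 2))\<^sup>2" by (rule uv)
        finally show "(a + b) / 2 \<in> ?K" by (auto intro: power2_less_imp_less)
      qed measurable
      then show ?thesis using True by simp
    next
      case False
      have "?A = {}" "?B = {}" if "1 \<le> \<tau>"
      proof -
        have "s \<le> \<tau> * s" "t \<le> \<tau> * t" using that s t by simp_all
        then have "\<not> \<tau> * s < u a" "\<not> \<tau> * t < v a" for a using us[of a] vt[of a] by linarith+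
        then show "?A = {}" "?B = {}" by blast+
      qed
      then show ?thesis using False by (cases "\<tau> \<le> 0") auto
    qed
  qed
  also have "\<dots> = 2 * (\<integral>\<^sup>+x. ennreal (std_normal_density x / c) \<partial>lborel)"
    using c nn_integral_layer_cake[of std_normal_density c] by (subst nn_integral_cmult) auto
  also have "(\<integral>\<^sup>+x. ennreal (std_normal_density x / c) \<partial>lborel)
      = (\<integral>\<^sup>+x. ennreal (1 / c) * ennreal (std_normal_density x) \<partial>lborel)"
    using c by (simp flip: ennreal_mult)
  also have "\<dots> = ennreal (1 / c)"
  proof -
    have "(\<integral>\<^sup>+x. ennreal (std_normal_density x) \<partial>lborel) = 1"
      using prob_space.emeasure_space_1[OF prob_space_normal_density, of 1 0]
      by (simp add: emeasure_density)
    then show ?thesis by (simp add: nn_integral_cmult)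
  qed
  finally have UV: "?U + ?V \<le> 2 * ennreal (1 / c)" .
  then have "?U + ?V < \<top>" by (rule le_less_trans) (simp add: ennreal_mult_less_top)
  then have fin: "?U \<noteq> \<top>" "?V \<noteq> \<top>" by auto
  have ex: "\<exists>r\<ge>0. x = ennreal r" if "x \<noteq> \<top>" for x using that by (cases x) auto
  obtain U where U: "0 \<le> U" "?U = ennreal U" using ex[OF fin(1)] by blast
  obtain V where V: "0 \<le> V" "?V = ennreal V" using ex[OF fin(2)] by blast
  have "ennreal (U + V) \<le> ennreal (2 / c)"
    using UV c U V by (simp add: ennreal_plus flip: ennreal_numeral ennreal_mult)
  then have UVc: "U + V \<le> 2 / c" using c by (simp add: ennreal_le_iff)
  \<comment> \<open>The arithmetic-geometric mean inequality turns the bound on the sum of the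
    normalised integrals into one on their product; the factors \<open>s\<close> and
    \<open>t\<close> then cancel against \<open>c\<^sup>2 = s * t\<close>.\<close>
  have "4 * (U * V) \<le> (U + V)\<^sup>2" using zero_le_power2[of "U - V"] by (simp add: power2_eq_square algebra_simps)
  also have "\<dots> \<le> (2 / c)\<^sup>2" using UVc U V by (intro power_mono) auto
  finally have "U * V \<le> 1 / (s * t)" by (simp add: power_divide c(2))
  then have *: "(s * U) * (t * V) \<le> 1" using s t by (simp add: field_simps)
  have "(\<integral>\<^sup>+a. u a \<partial>lborel) = (\<integral>\<^sup>+a. ennreal s * ennreal (u a / s) \<partial>lborel)"
    using s nn by (simp flip: ennreal_mult)
  also have "\<dots> = ennreal (s * U)" using U s by (simp add: nn_integral_cmult ennreal_mult)
  finally have 1: "(\<integral>\<^sup>+a. u a \<partial>lborel) = ennreal (s * U)" .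
  have "(\<integral>\<^sup>+b. v b \<partial>lborel) = (\<integral>\<^sup>+b. ennreal t * ennreal (v b / t) \<partial>lborel)"
    using t nn by (simp flip: ennreal_mult)
  also have "\<dots> = ennreal (t * V)" using V t by (simp add: nn_integral_cmult ennreal_mult)
  finally have 2: "(\<integral>\<^sup>+b. v b \<partial>lborel) = ennreal (t * V)" .
  show ?thesis
    unfolding 1 2 using * U V s t by (simp flip: ennreal_mult ennreal_1 add: ennreal_leI)
qed

text \<open>Maurey's property (tau), chosen because it tensorises.\<close>

lemma normal_property_tau:
  fixes f g :: "real \<Rightarrow> ennreal"
  assumes [measurable]: "f \<in> borel_measurable borel" "g \<in> borel_measurable borel"
    and fg: "\<And>a b. f a * g b \<le> ennreal (exp ((a - b)\<^sup>2 / 4))"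
  shows "(\<integral>\<^sup>+a. f a \<partial>std_normal_distribution) * (\<integral>\<^sup>+b. g b \<partial>std_normal_distribution) \<le> 1"
proof (cases "(\<exists>a. f a \<noteq> 0) \<and> (\<exists>b. g b \<noteq> 0)")
  case False
  then have "(\<forall>a. f a = 0) \<or> (\<forall>b. g b = 0)" by blast
  then show ?thesis by auto
next
  case True
  then obtain a0 b0 where 0: "f a0 \<noteq> 0" "g b0 \<noteq> 0" by blast
  \<comment> \<open>An infinite value of one function, multiplied by a nonzero value of the other,
    would violate the finite bound \<open>fg\<close>; so both can be treated as real-valued.\<close>
  have fin: "f a \<noteq> \<top>" "g b \<noteq> \<top>" for a b
  proof -
    have "f a * g b0 \<noteq> \<top>" "f a0 * g b \<noteq> \<top>"
      using fg[of a b0] fg[of a0 b] by (auto simp: top_unique)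
    then show "f a \<noteq> \<top>" "g b \<noteq> \<top>" using 0 by (auto simp: ennreal_mult_eq_top_iff)
  qed
  define u v where "u a = std_normal_density a * enn2real (f a)"
    and "v b = std_normal_density b * enn2real (g b)" for a b
  have u: "ennreal (u a) = std_normal_density a * f a" for a
    using fin(1)[of a] by (simp add: u_def ennreal_mult less_top)
  have v: "ennreal (v b) = std_normal_density b * g b" for b
    using fin(2)[of b] by (simp add: v_def ennreal_mult less_top)
  have [measurable]: "u \<in> borel_measurable borel" "v \<in> borel_measurable borel"
    unfolding u_def v_def by measurable
  have "(\<integral>\<^sup>+a. u a \<partial>lborel) * (\<integral>\<^sup>+b. v b \<partial>lborel) \<le> 1"
  proof (rule prekopa_leindler_normal)
    show "0 \<le> u a" "0 \<le> v b" for a b by (simp_all add: u_def v_def)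
    show "0 < u a0" "0 < v b0"
      using 0 fin by (auto simp: u_def v_def enn2real_positive_iff less_top zero_less_iff_neq_zero
          intro!: mult_pos_pos normal_density_pos)
    fix a b
    have "ennreal (enn2real (f a) * enn2real (g b)) \<le> ennreal (exp ((a - b)\<^sup>2 / 4))"
      using fg[of a b] fin by (simp add: ennreal_mult less_top)
    then have fg': "enn2real (f a) * enn2real (g b) \<le> exp ((a - b)\<^sup>2 / 4)" by (simp add: ennreal_le_iff)
    have "u a * v b = (std_normal_density a * std_normal_density b) * (enn2real (f a) * enn2real (g b))"
      by (simp add: u_def v_def)
    also have "\<dots> \<le> (std_normal_density a * std_normal_density b) * exp ((a - b)\<^sup>2 / 4)"
      by (intro mult_left_mono fg') simp
    also have "\<dots> = exp (- a\<^sup>2 / 2 + - b\<^sup>2 / 2 + (a - b)\<^sup>2 / 4) / (2 * pi)"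
      by (simp only: std_normal_density_def exp_add) simp
    \<comment> \<open>Parallelogram law: the cost \<open>(a - b)\<^sup>2 / 4\<close> is exactly what
      separates the product of the densities from the squared density at the midpoint.\<close>
    also have "- a\<^sup>2 / 2 + - b\<^sup>2 / 2 + (a - b)\<^sup>2 / 4 = - ((a + b) / 2)\<^sup>2 / 2 + - ((a + b) / 2)\<^sup>2 / 2"
      by (simp add: power2_eq_square field_simps)
    also have "exp \<dots> / (2 * pi) = (std_normal_density ((a + b) / 2))\<^sup>2"
      by (simp only: std_normal_density_def exp_add power2_eq_square) simp
    finally show "u a * v b \<le> (std_normal_density ((a + b) / 2))\<^sup>2" .
  qed measurable
  then show ?thesis by (simp add: u v nn_integral_density)
qed

section \<open>Concentration for product Gaussian measures\<close>

abbreviation gauss :: "'i set \<Rightarrow> ('i \<Rightarrow> real) measure" where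
  "gauss I \<equiv> Pi\<^sub>M I (\<lambda>_. std_normal_distribution)"

lemma prob_space_gauss: "prob_space (gauss I)"
  by (intro prob_space_PiM prob_space_normal_density) simp

interpretation normal: prob_space std_normal_distribution
  by (rule prob_space_normal_density) simp

interpretation gauss: product_sigma_finite "\<lambda>_. std_normal_distribution"
  by standard

text \<open>Tensorisation. With the new coordinates frozen at \<open>y\<close> and \<open>z\<close>,
  the induction hypothesis applies to the sections, that of \<open>g\<close> scaled by
  \<open>exp (- (y - z)\<^sup>2 / 4)\<close>; hence the partial integrals satisfy the
  one-dimensional hypothesis. With values in \<open>ennreal\<close> these integrals may be infinite
  a priori.\<close>

lemma gauss_property_tau:
  fixes f g :: "('i \<Rightarrow> real) \<Rightarrow> ennreal"
  assumes "finite I" "f \<in> borel_measurable (gauss I)" "g \<in> borel_measurable (gauss I)"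
    and "\<And>a b. a \<in> space (gauss I) \<Longrightarrow> b \<in> space (gauss I)
      \<Longrightarrow> f a * g b \<le> ennreal (exp ((\<Sum>i\<in>I. (a i - b i)\<^sup>2) / 4))"
  shows "(\<integral>\<^sup>+a. f a \<partial>gauss I) * (\<integral>\<^sup>+b. g b \<partial>gauss I) \<le> 1"
  using assms
proof (induction I arbitrary: f g rule: finite_induct)
  case empty
  then show ?case by (simp add: PiM_empty nn_integral_count_space_finite space_PiM_empty)
next
  case (insert i I)
  note [measurable] = insert.prems(1,2)
  have upd[measurable]: "(\<lambda>x. x(i := y)) \<in> gauss I \<rightarrow>\<^sub>M gauss (insert i I)" for y
    by (rule measurable_fun_upd[where J = I]) auto
  have upd2[measurable]: "(\<lambda>(y, x). x(i := y)) \<in> borel \<Otimes>\<^sub>M gauss I \<rightarrow>\<^sub>M gauss (insert i I)"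
    using measurable_compose[OF measurable_pair_swap' measurable_add_dim[of i I "\<lambda>_. std_normal_distribution"]]
    by (simp add: split_beta' cong: measurable_cong_sets)
  interpret I: prob_space "gauss I" by (rule prob_space_gauss)
  let ?F = "\<lambda>y. \<integral>\<^sup>+x. f (x(i := y)) \<partial>gauss I" and ?G = "\<lambda>y. \<integral>\<^sup>+x. g (x(i := y)) \<partial>gauss I"
  have "(\<integral>\<^sup>+y. ?F y \<partial>std_normal_distribution) * (\<integral>\<^sup>+y. ?G y \<partial>std_normal_distribution) \<le> 1"
  proof (rule normal_property_tau)
    show "?F \<in> borel_measurable borel" "?G \<in> borel_measurable borel"
      by measurable
    fix y z :: real
    let ?e = "exp ((y - z)\<^sup>2 / 4)"
    have "?F y * (\<integral>\<^sup>+x. ennreal (1 / ?e) * g (x(i := z)) \<partial>gauss I) \<le> 1"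
    proof (rule insert.IH)
      fix a b assume ab: "a \<in> space (gauss I)" "b \<in> space (gauss I)"
      have "f (a(i := y)) * g (b(i := z))
          \<le> ennreal (exp ((\<Sum>j\<in>insert i I. ((a(i := y)) j - (b(i := z)) j)\<^sup>2) / 4))"
        using ab by (intro insert.prems) (auto simp: space_PiM PiE_def extensional_def)
      also have "(\<Sum>j\<in>insert i I. ((a(i := y)) j - (b(i := z)) j)\<^sup>2)
          = (y - z)\<^sup>2 + (\<Sum>j\<in>I. (a j - b j)\<^sup>2)"
        using insert.hyps by (auto intro!: sum.cong)
      finally have "ennreal (1 / ?e) * (f (a(i := y)) * g (b(i := z)))
          \<le> ennreal (1 / ?e) * ennreal (exp (((y - z)\<^sup>2 + (\<Sum>j\<in>I. (a j - b j)\<^sup>2)) / 4))"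
        by (rule mult_left_mono) simp
      also have "\<dots> = ennreal (exp ((\<Sum>j\<in>I. (a j - b j)\<^sup>2) / 4))"
        by (simp add: add_divide_distrib exp_add flip: ennreal_mult)
      finally show "f (a(i := y)) * (ennreal (1 / ?e) * g (b(i := z)))
          \<le> ennreal (exp ((\<Sum>j\<in>I. (a j - b j)\<^sup>2) / 4))"
        by (simp add: ac_simps)
    qed measurable
    also have "(\<integral>\<^sup>+x. ennreal (1 / ?e) * g (x(i := z)) \<partial>gauss I) = ennreal (1 / ?e) * ?G z"
      by (rule nn_integral_cmult) measurable
    finally have "ennreal ?e * (?F y * (ennreal (1 / ?e) * ?G z)) \<le> ennreal ?e * 1"
      by (rule mult_left_mono) simp
    moreover have "ennreal ?e * (?F y * (ennreal (1 / ?e) * ?G z))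
        = (ennreal ?e * ennreal (1 / ?e)) * (?F y * ?G z)"
      by (simp only: ac_simps)
    moreover have "ennreal ?e * ennreal (1 / ?e) = 1" by (simp flip: ennreal_mult)
    ultimately show "?F y * ?G z \<le> ennreal ?e" by simp
  qed
  then show ?case
    by (simp add: gauss.product_nn_integral_insert_rev insert.hyps)
qed

text \<open>Property (tau) for the indicator of \<open>A\<close> and \<open>exp (s / 4)\<close>
  times that of \<open>B\<close>. A set of substantial measure thus leaves only exponentially small
  measure at squared distance at least \<open>s\<close>.\<close>

lemma gauss_separated_sets:
  assumes "finite I" and [measurable]: "A \<in> sets (gauss I)" "B \<in> sets (gauss I)"
    and sep: "\<And>a b. a \<in> A \<Longrightarrow> b \<in> B \<Longrightarrow> s \<le> (\<Sum>i\<in>I. (a i - b i)\<^sup>2)"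
  shows "measure (gauss I) A * measure (gauss I) B \<le> exp (- s / 4)"
proof -
  interpret prob_space "gauss I" by (rule prob_space_gauss)
  have "(\<integral>\<^sup>+a. indicator A a \<partial>gauss I) * (\<integral>\<^sup>+b. ennreal (exp (s / 4)) * indicator B b \<partial>gauss I) \<le> 1"
    by (rule gauss_property_tau[OF assms(1)])
      (auto simp: indicator_def sep split: if_splits intro!: ennreal_leI divide_right_mono)
  then have "ennreal (measure (gauss I) A * (exp (s / 4) * measure (gauss I) B)) \<le> ennreal 1"
    by (simp add: nn_integral_cmult emeasure_eq_measure ennreal_mult)
  then have "measure (gauss I) A * (exp (s / 4) * measure (gauss I) B) \<le> 1"
    by (simp only: ennreal_le_iff)
  then show ?thesis by (simp add: exp_minus field_simps)
qed

section \<open>Rotations and moments of Gaussian vectors\<close>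

text \<open>One planar rotation acts on every pair \<open>(x i, y i)\<close>. When \<open>c\<close>
  and \<open>s\<close> are cosine and sine, the second component is the derivative of the first with
  respect to the angle, which is how directional derivatives enter.\<close>

definition gauss_rotate :: "'i set \<Rightarrow> real \<Rightarrow> real \<Rightarrow> ('i \<Rightarrow> real) \<times> ('i \<Rightarrow> real) \<Rightarrow> ('i \<Rightarrow> real) \<times> ('i \<Rightarrow> real)" where
  "gauss_rotate I c s = (\<lambda>(x, y). (\<lambda>i\<in>I. c * x i + s * y i, \<lambda>i\<in>I. - s * x i + c * y i))"

lemma measurable_gauss_rotate [measurable]:
  "gauss_rotate I c s \<in> gauss I \<Otimes>\<^sub>M gauss I \<rightarrow>\<^sub>M gauss I \<Otimes>\<^sub>M gauss I"
  unfolding gauss_rotate_def by measurable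

lemma measurable_gauss_upd:
  "(\<lambda>(x, y). x(i := y)) \<in> gauss I \<Otimes>\<^sub>M borel \<rightarrow>\<^sub>M gauss (insert i I)"
  using measurable_add_dim[of i I "\<lambda>_. std_normal_distribution"]
  by (simp cong: measurable_cong_sets)

lemma sigma_finite_gauss: "sigma_finite_measure (gauss I)"
  by (intro prob_space_imp_sigma_finite prob_space_gauss)

lemma pair_sigma_finite_gauss: "pair_sigma_finite (gauss I) (gauss J)"
  by (intro pair_sigma_finite.intro sigma_finite_gauss)

text \<open>The coordinate pairs are rotated separately, so induction splits off one pair, treated
  by \<open>nn_integral_normal_rotate\<close>, and leaves the others to the induction
  hypothesis.\<close>

lemma nn_integral_gauss_rotate_iterated:
  assumes "finite I" and "H \<in> borel_measurable (gauss I \<Otimes>\<^sub>M gauss I)" and cs: "c\<^sup>2 + s\<^sup>2 = 1" "c \<noteq> -1"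
  shows "(\<integral>\<^sup>+x. \<integral>\<^sup>+y. H (gauss_rotate I c s (x, y)) \<partial>gauss I \<partial>gauss I)
    = (\<integral>\<^sup>+x. \<integral>\<^sup>+y. H (x, y) \<partial>gauss I \<partial>gauss I)"
  using assms(1,2)
proof (induction I arbitrary: H rule: finite_induct)
  case empty
  then show ?case by (simp add: PiM_empty nn_integral_count_space_finite gauss_rotate_def)
next
  case (insert i I)
  let ?N = std_normal_distribution
  note [measurable] = insert.prems measurable_gauss_upd[of i I]
  have [measurable]: "(\<lambda>p. (fst p)(i := snd p)) \<in> gauss I \<Otimes>\<^sub>M borel \<rightarrow>\<^sub>M gauss (insert i I)"
    using measurable_gauss_upd[of i I] by (simp add: split_beta')
  interpret II: pair_sigma_finite "gauss I" "gauss I" by (rule pair_sigma_finite_gauss)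
  interpret IN: pair_sigma_finite "gauss I" ?N
    by (intro pair_sigma_finite.intro sigma_finite_gauss normal.sigma_finite_measure_axioms)
  \<comment> \<open>Coordinate \<open>i\<close> is split off from both vectors, and Fubini moves its
    two scalar integrals innermost, where the planar result applies for fixed \<open>x\<close> and
    \<open>y\<close>.\<close>
  have ins: "(\<integral>\<^sup>+x. \<integral>\<^sup>+y. K (x, y) \<partial>gauss (insert i I) \<partial>gauss (insert i I))
      = (\<integral>\<^sup>+x. \<integral>\<^sup>+y. \<integral>\<^sup>+a. \<integral>\<^sup>+b. K (x(i := a), y(i := b)) \<partial>?N \<partial>?N \<partial>gauss I \<partial>gauss I)"
    if [measurable]: "K \<in> borel_measurable (gauss (insert i I) \<Otimes>\<^sub>M gauss (insert i I))" for K
  proof -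
    have upd: "(\<lambda>y. y(i := b)) \<in> gauss I \<rightarrow>\<^sub>M gauss (insert i I)" for b
      by (rule measurable_fun_upd[where J = I]) auto
    have "(\<integral>\<^sup>+x. \<integral>\<^sup>+y. K (x, y) \<partial>gauss (insert i I) \<partial>gauss (insert i I))
      = (\<integral>\<^sup>+x. \<integral>\<^sup>+a. \<integral>\<^sup>+y. K (x(i := a), y) \<partial>gauss (insert i I) \<partial>?N \<partial>gauss I)"
    proof (rule gauss.product_nn_integral_insert[OF insert.hyps])
      interpret J: sigma_finite_measure "gauss (insert i I)" by (rule sigma_finite_gauss)
      show "(\<lambda>x. \<integral>\<^sup>+y. K (x, y) \<partial>gauss (insert i I)) \<in> borel_measurable (gauss (insert i I))"
        by measurable
    qed
    also have "\<dots> = (\<integral>\<^sup>+x. \<integral>\<^sup>+a. \<integral>\<^sup>+y. \<integral>\<^sup>+b. K (x(i := a), y(i := b)) \<partial>?N \<partial>gauss I \<partial>?N \<partial>gauss I)"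
    proof (rule nn_integral_cong, rule nn_integral_cong)
      fix x a assume x: "x \<in> space (gauss I)" and a: "a \<in> space ?N"
      then have [measurable]: "x(i := a) \<in> space (gauss (insert i I))"
        by (auto simp: space_PiM PiE_def extensional_def)
      show "(\<integral>\<^sup>+y. K (x(i := a), y) \<partial>gauss (insert i I))
          = (\<integral>\<^sup>+y. \<integral>\<^sup>+b. K (x(i := a), y(i := b)) \<partial>?N \<partial>gauss I)"
        by (rule gauss.product_nn_integral_insert[OF insert.hyps]) measurable
    qed
    also have "\<dots> = (\<integral>\<^sup>+x. \<integral>\<^sup>+y. \<integral>\<^sup>+a. \<integral>\<^sup>+b. K (x(i := a), y(i := b)) \<partial>?N \<partial>?N \<partial>gauss I \<partial>gauss I)"
    proof (rule nn_integral_cong)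
      fix x assume x: "x \<in> space (gauss I)"
      then have [measurable]: "(\<lambda>a. x(i := a)) \<in> borel \<rightarrow>\<^sub>M gauss (insert i I)"
        using measurable_Pair2[OF measurable_gauss_upd[of i I] x] by simp
      show "(\<integral>\<^sup>+a. \<integral>\<^sup>+y. \<integral>\<^sup>+b. K (x(i := a), y(i := b)) \<partial>?N \<partial>gauss I \<partial>?N)
          = (\<integral>\<^sup>+y. \<integral>\<^sup>+a. \<integral>\<^sup>+b. K (x(i := a), y(i := b)) \<partial>?N \<partial>?N \<partial>gauss I)"
      proof (rule IN.Fubini')
        have "(\<lambda>(y, a). \<integral>\<^sup>+b. K (x(i := a), y(i := b)) \<partial>?N) \<in> borel_measurable (gauss I \<Otimes>\<^sub>M borel)"
          by measurable
        then show "(\<lambda>(y, a). \<integral>\<^sup>+b. K (x(i := a), y(i := b)) \<partial>?N) \<in> borel_measurable (gauss I \<Otimes>\<^sub>M ?N)"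
          by (simp cong: measurable_cong_sets)
      qed
    qed
    finally show ?thesis .
  qed
  have rot: "gauss_rotate (insert i I) c s (x(i := a), y(i := b))
      = ((fst (gauss_rotate I c s (x, y)))(i := c * a + s * b),
         (snd (gauss_rotate I c s (x, y)))(i := - s * a + c * b))" for x y a b
    using insert.hyps by (auto simp: gauss_rotate_def fun_eq_iff)
  let ?L = "\<lambda>p. \<integral>\<^sup>+a. \<integral>\<^sup>+b. H ((fst p)(i := a), (snd p)(i := b)) \<partial>?N \<partial>?N"
  have "(\<integral>\<^sup>+x. \<integral>\<^sup>+y. H (gauss_rotate (insert i I) c s (x, y)) \<partial>gauss (insert i I) \<partial>gauss (insert i I))
      = (\<integral>\<^sup>+x. \<integral>\<^sup>+y. \<integral>\<^sup>+a. \<integral>\<^sup>+b. H (gauss_rotate (insert i I) c s (x(i := a), y(i := b))) \<partial>?N \<partial>?N \<partial>gauss I \<partial>gauss I)"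
    by (rule ins) measurable
  also have "\<dots> = (\<integral>\<^sup>+x. \<integral>\<^sup>+y. ?L (gauss_rotate I c s (x, y)) \<partial>gauss I \<partial>gauss I)"
  proof (rule nn_integral_cong, rule nn_integral_cong)
    fix x y assume xy: "x \<in> space (gauss I)" "y \<in> space (gauss I)"
    define x' y' where "x' = fst (gauss_rotate I c s (x, y))" and "y' = snd (gauss_rotate I c s (x, y))"
    have sp: "x' \<in> space (gauss I)" "y' \<in> space (gauss I)"
      by (auto simp: x'_def y'_def gauss_rotate_def space_PiM)
    have [measurable]: "(\<lambda>a. x'(i := a)) \<in> borel \<rightarrow>\<^sub>M gauss (insert i I)"
      "(\<lambda>a. y'(i := a)) \<in> borel \<rightarrow>\<^sub>M gauss (insert i I)"
      using measurable_Pair2[OF measurable_gauss_upd[of i I] sp(1)]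
        measurable_Pair2[OF measurable_gauss_upd[of i I] sp(2)] by simp_all
    have "(\<integral>\<^sup>+a. \<integral>\<^sup>+b. H (x'(i := c * a + s * b), y'(i := - s * a + c * b)) \<partial>?N \<partial>?N)
      = (\<integral>\<^sup>+a. \<integral>\<^sup>+b. H (x'(i := a), y'(i := b)) \<partial>?N \<partial>?N)"
      using nn_integral_normal_rotate[OF _ cs, of "\<lambda>(a, b). H (x'(i := a), y'(i := b))"] by simp
    then show "(\<integral>\<^sup>+a. \<integral>\<^sup>+b. H (gauss_rotate (insert i I) c s (x(i := a), y(i := b))) \<partial>?N \<partial>?N)
        = ?L (gauss_rotate I c s (x, y))"
      unfolding rot x'_def y'_def .
  qed
  also have "\<dots> = (\<integral>\<^sup>+x. \<integral>\<^sup>+y. ?L (x, y) \<partial>gauss I \<partial>gauss I)"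
    by (rule insert.IH) measurable
  also have "\<dots> = (\<integral>\<^sup>+x. \<integral>\<^sup>+y. H (x, y) \<partial>gauss (insert i I) \<partial>gauss (insert i I))"
    by (subst ins) simp_all
  finally show ?case .
qed

lemma nn_integral_gauss_rotate:
  assumes "finite I" and [measurable]: "H \<in> borel_measurable (gauss I \<Otimes>\<^sub>M gauss I)"
    and cs: "c\<^sup>2 + s\<^sup>2 = 1" "c \<noteq> -1"
  shows "(\<integral>\<^sup>+\<omega>. H (gauss_rotate I c s \<omega>) \<partial>(gauss I \<Otimes>\<^sub>M gauss I)) = (\<integral>\<^sup>+\<omega>. H \<omega> \<partial>(gauss I \<Otimes>\<^sub>M gauss I))"
proof -
  interpret I: sigma_finite_measure "gauss I" by (rule sigma_finite_gauss)
  show ?thesis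
    using nn_integral_gauss_rotate_iterated[OF assms]
    by (simp add: I.nn_integral_fst[symmetric] del: I.nn_integral_fst)
qed

section \<open>Second and fourth moments of Gaussian linear forms\<close>

lemma nn_integral_normal_moments:
  fixes a S :: real
  shows "(\<integral>\<^sup>+y. ennreal ((y * a + S)\<^sup>2) \<partial>std_normal_distribution) = ennreal (a\<^sup>2) + ennreal (S\<^sup>2)"
    and "(\<integral>\<^sup>+y. ennreal ((y * a + S) ^ 4) \<partial>std_normal_distribution)
      = ennreal (3 * a ^ 4) + ennreal (6 * a\<^sup>2) * ennreal (S\<^sup>2) + ennreal (S ^ 4)"
proof -
  let ?N = std_normal_distribution
  have 1: "has_bochner_integral ?N (\<lambda>y. y ^ 1) 0"
    using integrable_std_normal_distribution_moment[of 1] integral_std_normal_distribution_moment_odd[of 1]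
    by (simp add: has_bochner_integral_iff)
  have 3: "has_bochner_integral ?N (\<lambda>y. y ^ 3) 0"
    using integrable_std_normal_distribution_moment[of 3] integral_std_normal_distribution_moment_odd[of 3]
    by (simp add: has_bochner_integral_iff)
  have 2: "has_bochner_integral ?N (\<lambda>y. y ^ 2) 1"
    using std_normal_distribution_even_moments[of 1] by (simp add: has_bochner_integral_iff fact_numeral)
  have 4: "has_bochner_integral ?N (\<lambda>y. y ^ 4) 3"
    using std_normal_distribution_even_moments[of 2] by (simp add: has_bochner_integral_iff fact_numeral)
  have 0: "has_bochner_integral ?N (\<lambda>y. k) k" for k :: real
    using normal.prob_space by (simp add: has_bochner_integral_iff)
  have "has_bochner_integral ?N (\<lambda>y. a\<^sup>2 * y ^ 2 + (2 * a * S) * y ^ 1 + S\<^sup>2) (a\<^sup>2 * 1 + (2 * a * S) * 0 + S\<^sup>2)"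
    by (intro has_bochner_integral_add has_bochner_integral_mult_right 0 1 2 3 4)
  also have "(\<lambda>y. a\<^sup>2 * y ^ 2 + (2 * a * S) * y ^ 1 + S\<^sup>2) = (\<lambda>y. (y * a + S)\<^sup>2)"
    by (intro ext) algebra
  finally show "(\<integral>\<^sup>+y. ennreal ((y * a + S)\<^sup>2) \<partial>?N) = ennreal (a\<^sup>2) + ennreal (S\<^sup>2)"
    by (subst nn_integral_eq_integral) (auto simp: has_bochner_integral_iff)
  have "has_bochner_integral ?N (\<lambda>y. a ^ 4 * y ^ 4 + (4 * a ^ 3 * S) * y ^ 3 + (6 * a\<^sup>2 * S\<^sup>2) * y ^ 2
        + (4 * a * S ^ 3) * y ^ 1 + S ^ 4)
      (a ^ 4 * 3 + (4 * a ^ 3 * S) * 0 + (6 * a\<^sup>2 * S\<^sup>2) * 1 + (4 * a * S ^ 3) * 0 + S ^ 4)"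
    by (intro has_bochner_integral_add has_bochner_integral_mult_right 0 1 2 3 4)
  also have "(\<lambda>y. a ^ 4 * y ^ 4 + (4 * a ^ 3 * S) * y ^ 3 + (6 * a\<^sup>2 * S\<^sup>2) * y ^ 2
        + (4 * a * S ^ 3) * y ^ 1 + S ^ 4) = (\<lambda>y. (y * a + S) ^ 4)"
    by (intro ext) algebra
  finally show "(\<integral>\<^sup>+y. ennreal ((y * a + S) ^ 4) \<partial>?N)
      = ennreal (3 * a ^ 4) + ennreal (6 * a\<^sup>2) * ennreal (S\<^sup>2) + ennreal (S ^ 4)"
    by (subst nn_integral_eq_integral)
      (auto simp: has_bochner_integral_iff simp flip: ennreal_mult ennreal_plus)
qed

text \<open>A linear form is a centred Gaussian with variance
  \<open>\<Sum>i\<in>I. (a i)\<^sup>2\<close>. Its moments come from splitting off one coordinate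
  and expanding, the odd powers of that coordinate integrating to zero.\<close>

lemma gauss_linear_moments:
  assumes "finite I"
  shows "(\<integral>\<^sup>+x. ennreal ((\<Sum>i\<in>I. x i * a i)\<^sup>2) \<partial>gauss I) = ennreal (\<Sum>i\<in>I. (a i)\<^sup>2)"
    and "(\<integral>\<^sup>+x. ennreal ((\<Sum>i\<in>I. x i * a i) ^ 4) \<partial>gauss I) = ennreal (3 * (\<Sum>i\<in>I. (a i)\<^sup>2)\<^sup>2)"
  using assms
proof (induction I rule: finite_induct)
  case empty
  { case 1 then show ?case by (simp add: PiM_empty nn_integral_count_space_finite) }
  { case 2 then show ?case by (simp add: PiM_empty nn_integral_count_space_finite) }
next
  case (insert i I)
  interpret I: prob_space "gauss I" by (rule prob_space_gauss)
  have eq: "(\<Sum>j\<in>insert i I. (x(i := y)) j * a j) = y * a i + (\<Sum>j\<in>I. x j * a j)" for x y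
    using insert.hyps by (auto intro!: sum.cong)
  have nn: "0 \<le> (\<Sum>j\<in>I. (a j)\<^sup>2)" by (rule sum_nonneg) simp
  { case 1
    have "(\<integral>\<^sup>+x. ennreal ((\<Sum>j\<in>insert i I. x j * a j)\<^sup>2) \<partial>gauss (insert i I))
        = (\<integral>\<^sup>+x. \<integral>\<^sup>+y. ennreal ((y * a i + (\<Sum>j\<in>I. x j * a j))\<^sup>2) \<partial>std_normal_distribution \<partial>gauss I)"
      unfolding eq[symmetric] by (rule gauss.product_nn_integral_insert[OF insert.hyps]) measurable
    also have "\<dots> = ennreal ((a i)\<^sup>2) + ennreal (\<Sum>j\<in>I. (a j)\<^sup>2)"
      by (simp add: nn_integral_normal_moments nn_integral_add insert.IH I.emeasure_space_1)
    also have "\<dots> = ennreal (\<Sum>j\<in>insert i I. (a j)\<^sup>2)"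
      using nn by (simp add: insert.hyps flip: ennreal_plus)
    finally show ?case .
  }
  { case 2
    have "(\<integral>\<^sup>+x. ennreal ((\<Sum>j\<in>insert i I. x j * a j) ^ 4) \<partial>gauss (insert i I))
        = (\<integral>\<^sup>+x. \<integral>\<^sup>+y. ennreal ((y * a i + (\<Sum>j\<in>I. x j * a j)) ^ 4) \<partial>std_normal_distribution \<partial>gauss I)"
      unfolding eq[symmetric] by (rule gauss.product_nn_integral_insert[OF insert.hyps]) measurable
    also have "\<dots> = ennreal (3 * a i ^ 4) + ennreal (6 * (a i)\<^sup>2) * ennreal (\<Sum>j\<in>I. (a j)\<^sup>2)
          + ennreal (3 * (\<Sum>j\<in>I. (a j)\<^sup>2)\<^sup>2)"
      by (simp add: nn_integral_normal_moments nn_integral_add nn_integral_cmult insert.IH I.emeasure_space_1)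
    also have "\<dots> = ennreal (3 * a i ^ 4 + 6 * (a i)\<^sup>2 * (\<Sum>j\<in>I. (a j)\<^sup>2) + 3 * (\<Sum>j\<in>I. (a j)\<^sup>2)\<^sup>2)"
      using nn by (simp flip: ennreal_mult ennreal_plus)
    also have "3 * a i ^ 4 + 6 * (a i)\<^sup>2 * (\<Sum>j\<in>I. (a j)\<^sup>2) + 3 * (\<Sum>j\<in>I. (a j)\<^sup>2)\<^sup>2
        = 3 * (\<Sum>j\<in>insert i I. (a j)\<^sup>2)\<^sup>2"
      using insert.hyps by simp algebra
    finally show ?case .
  }
qed

section \<open>Polynomial functions and their gradients\<close>

text \<open>An inductive description makes measurability, differentiation and substitution of a
  rotation provable by rule induction. The index \<open>d\<close> only bounds the degree, since
  constants enter at every level.\<close>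

inductive poly_fun :: "'i set \<Rightarrow> nat \<Rightarrow> (('i \<Rightarrow> real) \<Rightarrow> real) \<Rightarrow> bool" for I where
  poly_fun_const: "poly_fun I d (\<lambda>_. c)"
| poly_fun_add: "poly_fun I d p \<Longrightarrow> poly_fun I d q \<Longrightarrow> poly_fun I d (\<lambda>x. p x + q x)"
| poly_fun_var: "i \<in> I \<Longrightarrow> poly_fun I d p \<Longrightarrow> poly_fun I (Suc d) (\<lambda>x. x i * p x)"

lemma poly_fun_mono: "poly_fun I d p \<Longrightarrow> d \<le> e \<Longrightarrow> poly_fun I e p"
proof (induction d p arbitrary: e rule: poly_fun.induct)
  case (poly_fun_var i d p)
  then show ?case by (cases e) (auto intro: poly_fun.poly_fun_var)
qed (auto intro: poly_fun.intros)

lemma poly_fun_cmult: "poly_fun I d p \<Longrightarrow> poly_fun I d (\<lambda>x. c * p x)"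
proof (induction rule: poly_fun.induct)
  case (poly_fun_var i d p)
  have "poly_fun I (Suc d) (\<lambda>x. x i * (c * p x))" using poly_fun_var by (intro poly_fun.poly_fun_var)
  then show ?case by (simp add: algebra_simps)
qed (auto simp: distrib_left intro: poly_fun.intros)

lemma poly_fun_sum:
  assumes "finite J" "\<And>j. j \<in> J \<Longrightarrow> poly_fun I d (p j)"
  shows "poly_fun I d (\<lambda>x. \<Sum>j\<in>J. p j x)"
  using assms by (induction J rule: finite_induct) (auto intro: poly_fun.intros)

lemma measurable_poly_fun:
  assumes "poly_fun I d p"
  shows "p \<in> borel_measurable (gauss I)"
  using assms by induction (auto intro!: borel_measurable_times borel_measurable_add
      measurable_component_singleton[where M = "\<lambda>_. std_normal_distribution", simplified])

text \<open>Built on \<open>deriv\<close>, this is an operator on functions, so that higher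
  derivatives are iterates \<open>foldr pd l p\<close>; \<open>poly_fun_partial_derivative\<close>
  shows that the derivative exists for polynomial functions.\<close>

definition pd :: "'i \<Rightarrow> (('i \<Rightarrow> real) \<Rightarrow> real) \<Rightarrow> ('i \<Rightarrow> real) \<Rightarrow> real" where
  "pd i p x = deriv (\<lambda>t. p (x(i := t))) (x i)"

text \<open>Carrying the chain rule along arbitrary curves through the induction replaces a theory
  of multivariate differentiability. The clause for \<open>d = 0\<close> is separate because
  \<open>d - 1\<close> is truncated.\<close>

lemma poly_fun_gradient:
  assumes "finite I" "poly_fun I d p"
  shows "\<exists>P'. (d = 0 \<longrightarrow> (\<forall>i x. P' i x = 0)) \<and> (\<forall>i. poly_fun I (d - 1) (P' i)) \<and>
    (\<forall>\<xi> \<eta> t. (\<forall>i\<in>I. ((\<lambda>s. \<xi> s i) has_real_derivative \<eta> i) (at t)) \<longrightarrow>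
      ((\<lambda>s. p (\<xi> s)) has_real_derivative (\<Sum>i\<in>I. \<eta> i * P' i (\<xi> t))) (at t))"
  using assms(2)
proof (induction rule: poly_fun.induct)
  case (poly_fun_const d c)
  show ?case by (intro exI[of _ "\<lambda>_ _. 0"]) (auto intro: poly_fun.intros)
next
  case (poly_fun_add d p q)
  obtain P' where P': "d = 0 \<longrightarrow> (\<forall>i x. P' i x = 0)" "\<forall>i. poly_fun I (d - 1) (P' i)"
    "\<And>\<xi> \<eta> t. (\<forall>i\<in>I. ((\<lambda>s. \<xi> s i) has_real_derivative \<eta> i) (at t)) \<Longrightarrow>
      ((\<lambda>s. p (\<xi> s)) has_real_derivative (\<Sum>i\<in>I. \<eta> i * P' i (\<xi> t))) (at t)"
    using poly_fun_add.IH(1) by metis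
  obtain Q' where Q': "d = 0 \<longrightarrow> (\<forall>i x. Q' i x = 0)" "\<forall>i. poly_fun I (d - 1) (Q' i)"
    "\<And>\<xi> \<eta> t. (\<forall>i\<in>I. ((\<lambda>s. \<xi> s i) has_real_derivative \<eta> i) (at t)) \<Longrightarrow>
      ((\<lambda>s. q (\<xi> s)) has_real_derivative (\<Sum>i\<in>I. \<eta> i * Q' i (\<xi> t))) (at t)"
    using poly_fun_add.IH(2) by metis
  show ?case
  proof (intro exI[of _ "\<lambda>i x. P' i x + Q' i x"] conjI allI impI)
    fix \<xi> :: "real \<Rightarrow> 'a \<Rightarrow> real" and \<eta> t
    assume *: "\<forall>i\<in>I. ((\<lambda>s. \<xi> s i) has_real_derivative \<eta> i) (at t)"
    show "((\<lambda>s. p (\<xi> s) + q (\<xi> s)) has_real_derivative (\<Sum>i\<in>I. \<eta> i * (P' i (\<xi> t) + Q' i (\<xi> t)))) (at t)"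
      using DERIV_add[OF P'(3)[OF *] Q'(3)[OF *]] by (simp add: distrib_left sum.distrib)
  qed (use P' Q' in \<open>auto intro: poly_fun.intros\<close>)
next
  case (poly_fun_var i d p)
  obtain P' where P': "d = 0 \<longrightarrow> (\<forall>i x. P' i x = 0)" "\<forall>i. poly_fun I (d - 1) (P' i)"
    "\<And>\<xi> \<eta> t. (\<forall>i\<in>I. ((\<lambda>s. \<xi> s i) has_real_derivative \<eta> i) (at t)) \<Longrightarrow>
      ((\<lambda>s. p (\<xi> s)) has_real_derivative (\<Sum>i\<in>I. \<eta> i * P' i (\<xi> t))) (at t)"
    using poly_fun_var.IH by metis
  show ?case
  proof (intro exI[of _ "\<lambda>j x. (if j = i then 1 else 0) * p x + x i * P' j x"] conjI allI impI)
    fix j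
    have "poly_fun I d (\<lambda>x. x i * P' j x)"
    proof (cases d)
      \<comment> \<open>Here \<open>d - 1 = d\<close>, so multiplication by \<open>x i\<close> would
        exceed the degree; the vanishing of the gradient saves the bound.\<close>
      case 0
      then show ?thesis using P'(1) by (simp add: poly_fun_const)
    next
      case (Suc e)
      then show ?thesis using P'(2) poly_fun_var.hyps(1) by (auto intro: poly_fun.poly_fun_var)
    qed
    then show "poly_fun I (Suc d - 1) (\<lambda>x. (if j = i then 1 else 0) * p x + x i * P' j x)"
      using poly_fun_var.hyps(2) by (auto intro!: poly_fun.poly_fun_add poly_fun_cmult simp: poly_fun_const)
  next
    fix \<xi> :: "real \<Rightarrow> 'a \<Rightarrow> real" and \<eta> t
    assume *: "\<forall>j\<in>I. ((\<lambda>s. \<xi> s j) has_real_derivative \<eta> j) (at t)"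
    have "(\<Sum>j\<in>I. \<eta> j * ((if j = i then 1 else 0) * p (\<xi> t) + \<xi> t i * P' j (\<xi> t)))
        = (\<Sum>j\<in>I. if j = i then \<eta> j * p (\<xi> t) else 0) + (\<Sum>j\<in>I. \<eta> j * P' j (\<xi> t)) * \<xi> t i"
      unfolding sum_distrib_right sum.distrib[symmetric] by (intro sum.cong) (auto simp: algebra_simps)
    then have "(\<Sum>j\<in>I. \<eta> j * ((if j = i then 1 else 0) * p (\<xi> t) + \<xi> t i * P' j (\<xi> t)))
        = \<eta> i * p (\<xi> t) + (\<Sum>j\<in>I. \<eta> j * P' j (\<xi> t)) * \<xi> t i"
      using assms(1) poly_fun_var.hyps(1) by (simp add: sum.delta)
    moreover have "((\<lambda>s. \<xi> s i * p (\<xi> s)) has_real_derivative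
        \<eta> i * p (\<xi> t) + (\<Sum>j\<in>I. \<eta> j * P' j (\<xi> t)) * \<xi> t i) (at t)"
      using poly_fun_var.hyps(1) * P'(3)[OF *] by (intro DERIV_mult) auto
    ultimately show "((\<lambda>s. \<xi> s i * p (\<xi> s)) has_real_derivative
        (\<Sum>j\<in>I. \<eta> j * ((if j = i then 1 else 0) * p (\<xi> t) + \<xi> t i * P' j (\<xi> t)))) (at t)"
      by simp
  qed simp
qed

text \<open>Following a coordinate line \<open>s \<mapsto> x(i := s)\<close> with the chain rule
  identifies the witness of \<open>poly_fun_gradient\<close> with \<open>pd\<close>.\<close>

lemma
  assumes "finite I" "poly_fun I d p"
  shows poly_fun_pd: "i \<in> I \<Longrightarrow> poly_fun I (d - 1) (pd i p)"
    and pd_degree_0: "i \<in> I \<Longrightarrow> d = 0 \<Longrightarrow> pd i p x = 0"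
    and poly_fun_chain_rule: "(\<And>i. i \<in> I \<Longrightarrow> ((\<lambda>s. \<xi> s i) has_real_derivative \<eta> i) (at t)) \<Longrightarrow>
      ((\<lambda>s. p (\<xi> s)) has_real_derivative (\<Sum>i\<in>I. \<eta> i * pd i p (\<xi> t))) (at t)"
proof -
  obtain P' where P': "(d = 0 \<longrightarrow> (\<forall>i x. P' i x = 0)) \<and> (\<forall>i. poly_fun I (d - 1) (P' i)) \<and>
    (\<forall>\<xi> \<eta> t. (\<forall>i\<in>I. ((\<lambda>s. \<xi> s i) has_real_derivative \<eta> i) (at t)) \<longrightarrow>
      ((\<lambda>s. p (\<xi> s)) has_real_derivative (\<Sum>i\<in>I. \<eta> i * P' i (\<xi> t))) (at t))"
    using poly_fun_gradient[OF assms] ..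
  have eq: "P' i = pd i p" if i: "i \<in> I" for i
  proof
    fix x
    have "((\<lambda>s. p (x(i := s))) has_real_derivative
        (\<Sum>j\<in>I. (if j = i then 1 else 0) * P' j (x(i := x i)))) (at (x i))"
      by (rule P'[THEN conjunct2, THEN conjunct2, rule_format, of "\<lambda>s. x(i := s)" "\<lambda>j. if j = i then 1 else 0"])
        auto
    also have "(\<Sum>j\<in>I. (if j = i then 1 else 0) * P' j (x(i := x i))) = P' i x"
      using i assms(1) by (simp add: if_distrib[of "\<lambda>c. c * _"] sum.delta cong: if_cong)
    finally show "P' i x = pd i p x" unfolding pd_def by (rule DERIV_imp_deriv[symmetric])
  qed
  show "i \<in> I \<Longrightarrow> poly_fun I (d - 1) (pd i p)" "i \<in> I \<Longrightarrow> d = 0 \<Longrightarrow> pd i p x = 0"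
    using P' by (auto simp flip: eq)
  assume *: "\<And>i. i \<in> I \<Longrightarrow> ((\<lambda>s. \<xi> s i) has_real_derivative \<eta> i) (at t)"
  have "(\<Sum>i\<in>I. \<eta> i * pd i p (\<xi> t)) = (\<Sum>i\<in>I. \<eta> i * P' i (\<xi> t))" by (simp add: eq)
  then show "((\<lambda>s. p (\<xi> s)) has_real_derivative (\<Sum>i\<in>I. \<eta> i * pd i p (\<xi> t))) (at t)"
    using P'[THEN conjunct2, THEN conjunct2, rule_format, of \<xi> \<eta> t] * by simp
qed

lemma poly_fun_partial_derivative:
  assumes "finite I" "poly_fun I d p" "i \<in> I"
  shows "((\<lambda>s. p (x(i := s))) has_real_derivative pd i p x) (at (x i))"
proof -
  have "((\<lambda>s. p (x(i := s))) has_real_derivative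
      (\<Sum>j\<in>I. (if j = i then 1 else 0) * pd j p (x(i := x i)))) (at (x i))"
    by (rule poly_fun_chain_rule[OF assms(1,2)]) auto
  also have "(\<Sum>j\<in>I. (if j = i then 1 else 0) * pd j p (x(i := x i))) = pd i p x"
    using assms by (simp add: if_distrib[of "\<lambda>c. c * _"] sum.delta cong: if_cong)
  finally show ?thesis .
qed

lemma pd_sum:
  assumes "finite I" "finite J" "\<And>j. j \<in> J \<Longrightarrow> poly_fun I d (v j)" "i \<in> I"
  shows "pd i (\<lambda>x. \<Sum>j\<in>J. z j * v j x) x = (\<Sum>j\<in>J. z j * pd i (v j) x)"
  unfolding pd_def[of i "\<lambda>x. \<Sum>j\<in>J. z j * v j x"]
  using assms by (intro DERIV_imp_deriv DERIV_sum DERIV_cmult poly_fun_partial_derivative)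

lemma poly_fun_cong:
  assumes "poly_fun I d p" "\<And>i. i \<in> I \<Longrightarrow> x i = y i"
  shows "p x = p y"
  using assms by (induction rule: poly_fun.induct) auto

text \<open>In the half-angle parametrisation of cosine and sine, \<open>1 + t\<^sup>2\<close> times
  a rotated coordinate is a quadratic polynomial in \<open>t\<close>; one such factor for each
  degree clears all denominators.\<close>

lemma poly_fun_rotate_poly:
  assumes "poly_fun I d p"
  shows "\<exists>F. degree F \<le> 2 * d \<and> (\<forall>t::real. poly F t = (1 + t\<^sup>2) ^ d *
    p (\<lambda>i\<in>I. (1 - t\<^sup>2) / (1 + t\<^sup>2) * x i + 2 * t / (1 + t\<^sup>2) * y i))"
  using assms
proof (induction rule: poly_fun.induct)
  case (poly_fun_const d c)
  have "degree (smult c ([:1, 0, 1:] ^ d)) \<le> 2 * d"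
    by (rule order_trans[OF degree_smult_le]) (rule order_trans[OF degree_power_le], simp)
  then show ?case
    by (intro exI[of _ "smult c ([:1, 0, 1:] ^ d)"]) (auto simp: power2_eq_square)
next
  case (poly_fun_add d p q)
  obtain F where F: "degree F \<le> 2 * d \<and> (\<forall>t. poly F t = (1 + t\<^sup>2) ^ d * p (\<lambda>i\<in>I. (1 - t\<^sup>2) / (1 + t\<^sup>2) * x i + 2 * t / (1 + t\<^sup>2) * y i))"
    using poly_fun_add.IH(1) ..
  obtain G where G: "degree G \<le> 2 * d \<and> (\<forall>t. poly G t = (1 + t\<^sup>2) ^ d * q (\<lambda>i\<in>I. (1 - t\<^sup>2) / (1 + t\<^sup>2) * x i + 2 * t / (1 + t\<^sup>2) * y i))"
    using poly_fun_add.IH(2) ..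
  show ?case
  proof (intro exI[of _ "F + G"] conjI allI)
    show "degree (F + G) \<le> 2 * d" using F G by (simp add: degree_add_le)
  qed (use F G in \<open>simp only: poly_add distrib_left\<close>)
next
  case (poly_fun_var i d p)
  obtain F where F: "degree F \<le> 2 * d \<and> (\<forall>t. poly F t = (1 + t\<^sup>2) ^ d * p (\<lambda>i\<in>I. (1 - t\<^sup>2) / (1 + t\<^sup>2) * x i + 2 * t / (1 + t\<^sup>2) * y i))"
    using poly_fun_var.IH ..
  let ?L = "[:x i, 2 * y i, - x i:]"
  have pos: "1 + t\<^sup>2 \<noteq> 0" for t :: real by (metis add_pos_nonneg less_irrefl zero_le_power2 zero_less_one)
  have deg: "degree (?L * F) \<le> 2 + 2 * d"
    using F by (intro order_trans[OF degree_mult_le] add_mono) auto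
  have L: "poly ?L t = (1 + t\<^sup>2) * ((1 - t\<^sup>2) / (1 + t\<^sup>2) * x i + 2 * t / (1 + t\<^sup>2) * y i)" for t
    using pos[of t] by (simp add: distrib_left) (simp add: power2_eq_square algebra_simps)
  show ?case
  proof (intro exI[of _ "?L * F"] conjI allI)
    show "degree (?L * F) \<le> 2 * Suc d" using deg by simp
    fix t
    have "poly (?L * F) t = poly ?L t * poly F t" by (rule poly_mult)
    also have "poly F t = (1 + t\<^sup>2) ^ d * p (\<lambda>i\<in>I. (1 - t\<^sup>2) / (1 + t\<^sup>2) * x i + 2 * t / (1 + t\<^sup>2) * y i)" using F by blast
    finally show "poly (?L * F) t = (1 + t\<^sup>2) ^ Suc d *
        ((\<lambda>i\<in>I. (1 - t\<^sup>2) / (1 + t\<^sup>2) * x i + 2 * t / (1 + t\<^sup>2) * y i) i * p (\<lambda>i\<in>I. (1 - t\<^sup>2) / (1 + t\<^sup>2) * x i + 2 * t / (1 + t\<^sup>2) * y i))"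
      using poly_fun_var.hyps(1) by (simp only: L power_Suc restrict_apply' mult.assoc mult.left_commute)
  qed
qed

text \<open>The angle is \<open>2 * arctan t\<close>, whose derivative
  \<open>2 / (1 + t\<^sup>2)\<close> multiplies the tangential component. The angle pi is never
  reached, so the cosine avoids -1.\<close>

lemma rational_rotation:
  fixes t :: real
  shows "((1 - t\<^sup>2) / (1 + t\<^sup>2))\<^sup>2 + (2 * t / (1 + t\<^sup>2))\<^sup>2 = 1" "(1 - t\<^sup>2) / (1 + t\<^sup>2) \<noteq> - 1"
    and "((\<lambda>t. (1 - t\<^sup>2) / (1 + t\<^sup>2) * a + 2 * t / (1 + t\<^sup>2) * b) has_real_derivative
      2 / (1 + t\<^sup>2) * (- (2 * t / (1 + t\<^sup>2)) * a + (1 - t\<^sup>2) / (1 + t\<^sup>2) * b)) (at t)"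
proof -
  have pos: "0 < 1 + t\<^sup>2" by (simp add: add_pos_nonneg)
  have "((1 - t\<^sup>2) / (1 + t\<^sup>2))\<^sup>2 + (2 * t / (1 + t\<^sup>2))\<^sup>2 = ((1 - t\<^sup>2)\<^sup>2 + (2 * t)\<^sup>2) / (1 + t\<^sup>2)\<^sup>2"
    by (simp add: power_divide add_divide_distrib)
  also have "(1 - t\<^sup>2)\<^sup>2 + (2 * t)\<^sup>2 = (1 + t\<^sup>2)\<^sup>2" by algebra
  finally show "((1 - t\<^sup>2) / (1 + t\<^sup>2))\<^sup>2 + (2 * t / (1 + t\<^sup>2))\<^sup>2 = 1" using pos by simp
  show "(1 - t\<^sup>2) / (1 + t\<^sup>2) \<noteq> - 1" using pos by (simp add: divide_eq_eq)
  have D: "((\<lambda>t. 1 - t\<^sup>2) has_real_derivative 0 - 2 * t) (at t)"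
    "((\<lambda>t. 1 + t\<^sup>2) has_real_derivative 0 + 2 * t) (at t)"
    "((\<lambda>t. 2 * t) has_real_derivative 2 * 1) (at t)"
    by (auto intro!: derivative_eq_intros)
  have "((\<lambda>t. (1 - t\<^sup>2) / (1 + t\<^sup>2) * a + 2 * t / (1 + t\<^sup>2) * b) has_real_derivative
      ((0 - 2 * t) * (1 + t\<^sup>2) - (1 - t\<^sup>2) * (0 + 2 * t)) / ((1 + t\<^sup>2) * (1 + t\<^sup>2)) * a
      + ((2 * 1) * (1 + t\<^sup>2) - (2 * t) * (0 + 2 * t)) / ((1 + t\<^sup>2) * (1 + t\<^sup>2)) * b) (at t)"
    by (rule DERIV_add[OF DERIV_cmult_right[OF DERIV_divide[OF D(1,2)]]
          DERIV_cmult_right[OF DERIV_divide[OF D(3,2)]]]) (use pos in auto)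
  also have "((0 - 2 * t) * (1 + t\<^sup>2) - (1 - t\<^sup>2) * (0 + 2 * t)) / ((1 + t\<^sup>2) * (1 + t\<^sup>2)) * a
      + ((2 * 1) * (1 + t\<^sup>2) - (2 * t) * (0 + 2 * t)) / ((1 + t\<^sup>2) * (1 + t\<^sup>2)) * b
      = 2 / (1 + t\<^sup>2) * (- (2 * t / (1 + t\<^sup>2)) * a + (1 - t\<^sup>2) / (1 + t\<^sup>2) * b)"
    using pos by (simp add: divide_simps) (simp add: algebra_simps power2_eq_square)
  finally show "((\<lambda>t. (1 - t\<^sup>2) / (1 + t\<^sup>2) * a + 2 * t / (1 + t\<^sup>2) * b) has_real_derivative
      2 / (1 + t\<^sup>2) * (- (2 * t / (1 + t\<^sup>2)) * a + (1 - t\<^sup>2) / (1 + t\<^sup>2) * b)) (at t)" .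
qed

section \<open>Anticoncentration of a polynomial relative to its derivatives\<close>

text \<open>The product rule for \<open>F\<close> contains the derivative of \<open>w\<close> at
  \<open>u\<close> in direction \<open>v\<close>. Solving for it costs \<open>2 * m / r\<close> from
  the hypothesis on \<open>F\<close> and \<open>m / r\<close> from the derivative of the power of
  \<open>1 + t\<^sup>2\<close>.\<close>

lemma directional_derivative_rotated_bound:
  fixes x y :: "'i \<Rightarrow> real" and t r :: real and F :: "real poly"
  assumes "finite I" and w: "poly_fun I m w" and r: "0 < r" "r \<le> 1" and t: "0 \<le> t" "t \<le> 1"
    and F: "\<And>t. poly F t = (1 + t\<^sup>2) ^ m *
      w (\<lambda>i\<in>I. (1 - t\<^sup>2) / (1 + t\<^sup>2) * x i + 2 * t / (1 + t\<^sup>2) * y i)"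
    and bnd: "\<bar>poly (pderiv F) t\<bar> \<le> 2 * real m / r * \<bar>poly F t\<bar>"
    and uv: "gauss_rotate I ((1 - t\<^sup>2) / (1 + t\<^sup>2)) (2 * t / (1 + t\<^sup>2)) (x, y) = (u, v)"
  shows "\<bar>\<Sum>i\<in>I. v i * pd i w u\<bar> \<le> 3 * real m / r * \<bar>w u\<bar>"
proof -
  let ?\<xi> = "\<lambda>t. \<lambda>i\<in>I. (1 - t\<^sup>2) / (1 + t\<^sup>2) * x i + 2 * t / (1 + t\<^sup>2) * y i"
  let ?D = "\<Sum>i\<in>I. v i * pd i w u"
  define q where "q = 1 + t\<^sup>2"
  have q: "1 \<le> q" "q \<le> 2" using t power_le_one[of t 2] by (auto simp: q_def)
  have v: "v i = - (2 * t / (1 + t\<^sup>2)) * x i + (1 - t\<^sup>2) / (1 + t\<^sup>2) * y i" if "i \<in> I" for i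
    using uv that by (auto simp: gauss_rotate_def)
  have u: "u = ?\<xi> t" using uv by (auto simp: gauss_rotate_def)
  have "((\<lambda>t. w (?\<xi> t)) has_real_derivative (\<Sum>i\<in>I. (2 / q * v i) * pd i w (?\<xi> t))) (at t)"
  proof (rule poly_fun_chain_rule[OF assms(1) w])
    fix i assume i: "i \<in> I"
    show "((\<lambda>s. ?\<xi> s i) has_real_derivative 2 / q * v i) (at t)"
      using rational_rotation(3)[of "x i" "y i" t] i by (simp add: v q_def)
  qed
  also have "(\<Sum>i\<in>I. (2 / q * v i) * pd i w (?\<xi> t)) = 2 / q * ?D"
    by (simp only: u sum_distrib_left mult.assoc)
  finally have w': "((\<lambda>t. w (?\<xi> t)) has_real_derivative 2 / q * ?D) (at t)" .
  have "((\<lambda>t. (1 + t\<^sup>2) ^ m) has_real_derivative m * q ^ (m - 1) * (2 * t)) (at t)"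
    unfolding q_def by (auto intro!: derivative_eq_intros)
  from DERIV_mult[OF this w']
  have "((\<lambda>t. (1 + t\<^sup>2) ^ m * w (?\<xi> t)) has_real_derivative
      m * q ^ (m - 1) * (2 * t) * w u + 2 / q * ?D * q ^ m) (at t)"
    by (simp only: u q_def)
  then have "(poly F has_real_derivative m * q ^ (m - 1) * (2 * t) * w u + 2 / q * ?D * q ^ m) (at t)"
    by (simp only: F[abs_def])
  from DERIV_unique[OF poly_DERIV this]
  have "poly (pderiv F) t = m * q ^ (m - 1) * (2 * t) * w u + 2 / q * ?D * q ^ m" .
  then have "q * poly (pderiv F) t = m * (q * q ^ (m - 1)) * (2 * t) * w u + 2 * ?D * q ^ m"
    using q by (simp add: field_simps)
  \<comment> \<open>At \<open>m = 0\<close> the exponent is truncated, but the factor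
    \<open>m\<close> annihilates both sides.\<close>
  also have "m * (q * q ^ (m - 1)) = m * q ^ m" by (cases m) auto
  finally have "2 * ?D * q ^ m = q * poly (pderiv F) t - m * q ^ m * (2 * t) * w u" by simp
  then have "\<bar>2 * ?D * q ^ m\<bar> \<le> \<bar>q * poly (pderiv F) t\<bar> + \<bar>m * q ^ m * (2 * t) * w u\<bar>" by simp
  also have "\<bar>q * poly (pderiv F) t\<bar> = q * \<bar>poly (pderiv F) t\<bar>" using q by (simp add: abs_mult)
  also have "\<dots> \<le> 2 * (2 * real m / r * \<bar>poly F t\<bar>)" using q bnd by (intro mult_mono) auto
  also have "poly F t = q ^ m * w u" by (simp only: F u q_def)
  also have "\<bar>m * q ^ m * (2 * t) * w u\<bar> \<le> m * q ^ m * 2 / r * \<bar>w u\<bar>"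
  proof -
    have "t \<le> 1 / r" using t r by (simp add: field_simps) (meson mult_le_one order_trans)
    then have "m * q ^ m * (2 * t) * \<bar>w u\<bar> \<le> m * q ^ m * (2 * (1 / r)) * \<bar>w u\<bar>"
      using q by (intro mult_right_mono mult_left_mono) auto
    then show ?thesis using q t by (simp add: abs_mult)
  qed
  finally have "q ^ m * \<bar>?D\<bar> \<le> q ^ m * (3 * real m / r * \<bar>w u\<bar>)"
    using q r by (simp add: abs_mult field_simps)
  moreover have "0 < q ^ m" using q by simp
  ultimately show ?thesis by (simp only: mult_le_cancel_left_pos)
qed

text \<open>Rotation invariance lets the probability be averaged over \<open>t\<close> in
  \<open>{0..1}\<close>. For each fixed pair, \<open>emeasure_poly_derivative_large\<close> with
  degree \<open>2 * m\<close> bounds the exceptional \<open>t\<close> by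
  \<open>2 * (2 * m) * r\<close>; the choice \<open>r = 3 * m / M\<close> gives the constant
  12.\<close>

lemma directional_anticoncentration:
  assumes I: "finite I" and w: "poly_fun I m w" and M: "0 < M"
  shows "emeasure (gauss I \<Otimes>\<^sub>M gauss I)
      {\<omega> \<in> space (gauss I \<Otimes>\<^sub>M gauss I). M * \<bar>w (fst \<omega>)\<bar> < \<bar>\<Sum>i\<in>I. snd \<omega> i * pd i w (fst \<omega>)\<bar>}
    \<le> ennreal (12 * (real m)\<^sup>2 / M)" (is "emeasure ?P ?E \<le> _")
proof -
  interpret I: prob_space "gauss I" by (rule prob_space_gauss)
  interpret P: pair_prob_space "gauss I" "gauss I" ..
  note [measurable] = measurable_poly_fun[OF w] measurable_poly_fun[OF poly_fun_pd[OF I w]]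
  have E[measurable]: "?E \<in> sets ?P" by measurable
  show ?thesis
  \<comment> \<open>At \<open>m = 0\<close> the derivative vanishes, and for
    \<open>M < 3 * m\<close> the claimed bound is at least 1; otherwise
    \<open>r \<le> 1\<close>.\<close>
  proof (cases "m = 0 \<or> M < 3 * m")
    case True
    then show ?thesis
    proof
      assume "m = 0"
      then have "?E = {}" using pd_degree_0[OF I w] M by (auto simp: not_less)
      then show ?thesis by (simp only: emeasure_empty zero_le)
    next
      assume *: "M < 3 * m"
      then have "m \<noteq> 0" using M by auto
      then have "1 \<le> real m" by simp
      then have "M \<le> 12 * (m * real m)" using * mult_right_mono[of 1 "real m" "real m"] by linarith
      then have "M \<le> 12 * (real m)\<^sup>2" by (simp add: power2_eq_square)
      then have "1 \<le> 12 * (real m)\<^sup>2 / M" using M by (simp add: field_simps)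
      then show ?thesis by (intro order_trans[OF P.emeasure_le_1]) (simp flip: ennreal_1 add: ennreal_leI)
    qed
  next
    case False
    then have m: "0 < m" "3 * m \<le> M" by auto
    define r where "r = 3 * m / M"
    have r: "0 < r" "r \<le> 1" using m M by (auto simp: r_def)
    let ?c = "\<lambda>t::real. (1 - t\<^sup>2) / (1 + t\<^sup>2)" and ?s = "\<lambda>t::real. 2 * t / (1 + t\<^sup>2)"
    have rot[measurable]: "(\<lambda>(t, \<omega>). gauss_rotate I (?c t) (?s t) \<omega>) \<in> borel \<Otimes>\<^sub>M ?P \<rightarrow>\<^sub>M ?P"
      unfolding gauss_rotate_def by measurable
    interpret T: pair_sigma_finite lborel ?P ..
    have "emeasure ?P ?E = (\<integral>\<^sup>+t. emeasure ?P ?E * indicator {0..1::real} t \<partial>lborel)"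
      by (subst nn_integral_cmult_indicator) simp_all
    also have "\<dots> = (\<integral>\<^sup>+t. \<integral>\<^sup>+\<omega>. indicator ?E (gauss_rotate I (?c t) (?s t) \<omega>) * indicator {0..1} t \<partial>?P \<partial>lborel)"
    proof (intro nn_integral_cong)
      fix t :: real
      have "(\<integral>\<^sup>+\<omega>. indicator ?E (gauss_rotate I (?c t) (?s t) \<omega>) \<partial>?P) = (\<integral>\<^sup>+\<omega>. indicator ?E \<omega> \<partial>?P)"
        by (rule nn_integral_gauss_rotate[OF I _ rational_rotation(1,2)]) measurable
      then show "emeasure ?P ?E * indicator {0..1} t
          = (\<integral>\<^sup>+\<omega>. indicator ?E (gauss_rotate I (?c t) (?s t) \<omega>) * indicator {0..1} t \<partial>?P)"
        by (subst nn_integral_multc) auto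
    qed
    also have "\<dots> = (\<integral>\<^sup>+\<omega>. \<integral>\<^sup>+t. indicator ?E (gauss_rotate I (?c t) (?s t) \<omega>) * indicator {0..1} t \<partial>lborel \<partial>?P)"
      by (rule T.Fubini'[symmetric]) measurable
    also have "\<dots> \<le> (\<integral>\<^sup>+\<omega>. ennreal (12 * (real m)\<^sup>2 / M) \<partial>?P)"
    proof (rule nn_integral_mono)
      fix \<omega> assume "\<omega> \<in> space ?P"
      obtain x y where \<omega>: "\<omega> = (x, y)" by (cases \<omega>)
      obtain F where F: "degree F \<le> 2 * m \<and> (\<forall>t::real. poly F t = (1 + t\<^sup>2) ^ m *
          w (\<lambda>i\<in>I. (1 - t\<^sup>2) / (1 + t\<^sup>2) * x i + 2 * t / (1 + t\<^sup>2) * y i))"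
        using poly_fun_rotate_poly[OF w] ..
      let ?B = "{t \<in> {0..1}. real (2 * m) / r * \<bar>poly F t\<bar> < \<bar>poly (pderiv F) t\<bar>}"
      have "(\<integral>\<^sup>+t. indicator ?E (gauss_rotate I (?c t) (?s t) \<omega>) * indicator {0..1} t \<partial>lborel)
          \<le> (\<integral>\<^sup>+t. indicator ?B t \<partial>lborel)"
      proof (rule nn_integral_mono)
        fix t :: real
        obtain u v where uv: "gauss_rotate I (?c t) (?s t) (x, y) = (u, v)" by fastforce
        have "t \<in> ?B" if "t \<in> {0..1}" "(u, v) \<in> ?E"
        proof (rule ccontr)
          assume "t \<notin> ?B"
          then have "\<bar>poly (pderiv F) t\<bar> \<le> 2 * real m / r * \<bar>poly F t\<bar>" using that(1) by (simp add: not_less)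
          then have "\<bar>\<Sum>i\<in>I. v i * pd i w u\<bar> \<le> 3 * real m / r * \<bar>w u\<bar>"
            using that(1) F by (intro directional_derivative_rotated_bound[where F = F, OF I w r _ _ _ _ uv]) auto
          also have "3 * real m / r = M" using m M by (simp add: r_def)
          finally show False using that(2) by simp
        qed
        then show "indicator ?E (gauss_rotate I (?c t) (?s t) \<omega>) * indicator {0..1} t \<le> (indicator ?B t :: ennreal)"
          unfolding \<omega> uv by (auto simp: indicator_def)
      qed
      also have "\<dots> = emeasure lborel ?B"
      proof (rule nn_integral_indicator)
        have [measurable]: "poly G \<in> borel_measurable borel" for G :: "real poly"
          by (auto intro!: borel_measurable_continuous_onI continuous_at_imp_continuous_on)
        have "{0..1} \<inter> {t \<in> space borel. real (2 * m) / r * \<bar>poly F t\<bar> < \<bar>poly (pderiv F) t\<bar>} \<in> sets borel"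
          by measurable
        then show "?B \<in> sets lborel" by (simp add: Int_def)
      qed
      also have "\<dots> \<le> ennreal (2 * real (2 * m) * r)"
        using F r by (intro emeasure_poly_derivative_large) auto
      also have "2 * real (2 * m) * r = 12 * (real m)\<^sup>2 / M" using M by (simp add: r_def power2_eq_square)
      finally show "(\<integral>\<^sup>+t. indicator ?E (gauss_rotate I (?c t) (?s t) \<omega>) * indicator {0..1} t \<partial>lborel)
          \<le> ennreal (12 * (real m)\<^sup>2 / M)" .
    qed
    also have "\<dots> = ennreal (12 * (real m)\<^sup>2 / M)" by (simp add: P.emeasure_space_1)
    finally show ?thesis .
  qed
qed

section \<open>Gaussian chaos of order two and gradients\<close>

lemma sum_squares_bound_weighted:
  fixes A W :: "'a \<Rightarrow> real"
  assumes "finite I" and W: "\<And>i. i \<in> I \<Longrightarrow> 0 \<le> W i" "\<And>i. i \<in> I \<Longrightarrow> W i = 0 \<Longrightarrow> A i = 0"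
  shows "(\<Sum>i\<in>I. (A i)\<^sup>2)\<^sup>2 \<le> (\<Sum>i\<in>I. W i) * (\<Sum>i\<in>I. A i ^ 4 / W i)"
proof -
  have "(\<Sum>i\<in>I. (A i)\<^sup>2) = (\<Sum>i\<in>I. sqrt (W i) * ((A i)\<^sup>2 / sqrt (W i)))"
    using W by (intro sum.cong) auto
  then have "(\<Sum>i\<in>I. (A i)\<^sup>2)\<^sup>2 \<le> (\<Sum>i\<in>I. (sqrt (W i))\<^sup>2) * (\<Sum>i\<in>I. ((A i)\<^sup>2 / sqrt (W i))\<^sup>2)"
    using Cauchy_Schwarz_ineq_sum by metis
  also have "(\<Sum>i\<in>I. (sqrt (W i))\<^sup>2) = (\<Sum>i\<in>I. W i)" using W by (intro sum.cong) auto
  also have "(\<Sum>i\<in>I. ((A i)\<^sup>2 / sqrt (W i))\<^sup>2) = (\<Sum>i\<in>I. A i ^ 4 / W i)"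
    using W by (intro sum.cong) (auto simp: power_divide)
  finally show ?thesis .
qed

text \<open>Given \<open>z\<close>, the form is a centred Gaussian in \<open>y\<close> with variance
  \<open>\<Sum>i\<in>I. (?A z i)\<^sup>2\<close>. For the fourth moment,
  \<open>sum_squares_bound_weighted\<close> with the mean squares \<open>W i\<close> of
  \<open>?A z i\<close> as weights leaves only fourth moments of linear forms; each of the two
  integrations contributes a factor 3.\<close>

lemma gauss_bilinear_moments:
  fixes G :: "'j \<Rightarrow> 'i \<Rightarrow> real"
  assumes fin: "finite I" "finite J"
  defines "S \<equiv> \<Sum>j\<in>J. \<Sum>i\<in>I. (G j i)\<^sup>2"
  shows "(\<integral>\<^sup>+z. \<integral>\<^sup>+y. ennreal ((\<Sum>i\<in>I. y i * (\<Sum>j\<in>J. z j * G j i))\<^sup>2) \<partial>gauss I \<partial>gauss J) = ennreal S"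
    and "(\<integral>\<^sup>+z. \<integral>\<^sup>+y. ennreal ((\<Sum>i\<in>I. y i * (\<Sum>j\<in>J. z j * G j i)) ^ 4) \<partial>gauss I \<partial>gauss J) \<le> ennreal (9 * S\<^sup>2)"
proof -
  let ?A = "\<lambda>z i. \<Sum>j\<in>J. z j * G j i"
  define W where "W i = (\<Sum>j\<in>J. (G j i)\<^sup>2)" for i
  have W: "0 \<le> W i" for i by (simp add: W_def sum_nonneg)
  have SW: "S = (\<Sum>i\<in>I. W i)" unfolding S_def W_def by (rule sum.swap)
  have S: "0 \<le> S" by (simp add: SW W sum_nonneg)
  have "(\<integral>\<^sup>+z. \<integral>\<^sup>+y. ennreal ((\<Sum>i\<in>I. y i * ?A z i)\<^sup>2) \<partial>gauss I \<partial>gauss J)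
      = (\<integral>\<^sup>+z. (\<Sum>i\<in>I. ennreal ((?A z i)\<^sup>2)) \<partial>gauss J)"
    by (simp add: gauss_linear_moments fin)
  also have "\<dots> = (\<Sum>i\<in>I. \<integral>\<^sup>+z. ennreal ((?A z i)\<^sup>2) \<partial>gauss J)"
    by (rule nn_integral_sum) measurable
  also have "\<dots> = ennreal S" by (simp add: gauss_linear_moments fin SW W_def sum_nonneg)
  finally show "(\<integral>\<^sup>+z. \<integral>\<^sup>+y. ennreal ((\<Sum>i\<in>I. y i * ?A z i)\<^sup>2) \<partial>gauss I \<partial>gauss J) = ennreal S" .
  have zero: "?A z i = 0" if "W i = 0" for z i
    using that fin unfolding W_def by (subst (asm) sum_nonneg_eq_0_iff) auto
  have "(\<integral>\<^sup>+z. \<integral>\<^sup>+y. ennreal ((\<Sum>i\<in>I. y i * ?A z i) ^ 4) \<partial>gauss I \<partial>gauss J)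
      = (\<integral>\<^sup>+z. ennreal (3 * (\<Sum>i\<in>I. (?A z i)\<^sup>2)\<^sup>2) \<partial>gauss J)"
    by (simp add: gauss_linear_moments fin)
  also have "\<dots> \<le> (\<integral>\<^sup>+z. ennreal (3 * S) * (\<Sum>i\<in>I. ennreal (1 / W i) * ennreal (?A z i ^ 4)) \<partial>gauss J)"
  proof (rule nn_integral_mono)
    fix z
    have "3 * (\<Sum>i\<in>I. (?A z i)\<^sup>2)\<^sup>2 \<le> 3 * (S * (\<Sum>i\<in>I. ?A z i ^ 4 / W i))"
      unfolding SW using W zero by (intro mult_left_mono sum_squares_bound_weighted fin) auto
    then have "ennreal (3 * (\<Sum>i\<in>I. (?A z i)\<^sup>2)\<^sup>2) \<le> ennreal ((3 * S) * (\<Sum>i\<in>I. 1 / W i * ?A z i ^ 4))"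
      by (intro ennreal_leI) (simp add: mult.assoc)
    also have "\<dots> = ennreal (3 * S) * ennreal (\<Sum>i\<in>I. 1 / W i * ?A z i ^ 4)"
      using S W by (intro ennreal_mult) (auto intro!: sum_nonneg)
    also have "ennreal (\<Sum>i\<in>I. 1 / W i * ?A z i ^ 4) = (\<Sum>i\<in>I. ennreal (1 / W i * ?A z i ^ 4))"
      using W by (intro sum_ennreal[symmetric]) auto
    also have "\<dots> = (\<Sum>i\<in>I. ennreal (1 / W i) * ennreal (?A z i ^ 4))"
      using W by (intro sum.cong ennreal_mult) auto
    finally show "ennreal (3 * (\<Sum>i\<in>I. (?A z i)\<^sup>2)\<^sup>2)
        \<le> ennreal (3 * S) * (\<Sum>i\<in>I. ennreal (1 / W i) * ennreal (?A z i ^ 4))" .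
  qed
  also have "\<dots> = ennreal (3 * S) * (\<Sum>i\<in>I. ennreal (1 / W i) * (\<integral>\<^sup>+z. ennreal (?A z i ^ 4) \<partial>gauss J))"
    by (simp add: nn_integral_cmult nn_integral_sum)
  also have "\<dots> = ennreal (3 * S) * (\<Sum>i\<in>I. ennreal (1 / W i) * ennreal (3 * (W i)\<^sup>2))"
    by (simp add: gauss_linear_moments fin W_def)
  also have "(\<Sum>i\<in>I. ennreal (1 / W i) * ennreal (3 * (W i)\<^sup>2)) = (\<Sum>i\<in>I. ennreal (3 * W i))"
    using W by (intro sum.cong) (auto simp: power2_eq_square simp flip: ennreal_mult)
  also have "\<dots> = ennreal (3 * S)" using W by (simp add: SW sum_distrib_left)
  also have "ennreal (3 * S) * ennreal (3 * S) = ennreal (9 * S\<^sup>2)"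
    using S by (simp add: power2_eq_square flip: ennreal_mult)
  finally show "(\<integral>\<^sup>+z. \<integral>\<^sup>+y. ennreal ((\<Sum>i\<in>I. y i * ?A z i) ^ 4) \<partial>gauss I \<partial>gauss J) \<le> ennreal (9 * S\<^sup>2)" .
qed

text \<open>To be integrated with \<open>S\<close> the mean of \<open>X\<^sup>2\<close> and
  \<open>\<beta>\<close> the indicator of \<open>Y < X\<^sup>2\<close>. Above \<open>S / 2\<close>,
  the value \<open>X\<^sup>2\<close> is either at most \<open>Y\<close> or paid for by
  \<open>0 \<le> (X\<^sup>2 - 18 * S)\<^sup>2\<close>; the weight \<open>1 / (36 * S)\<close> makes
  a fourth moment of at most \<open>9 * S\<^sup>2\<close> cost only \<open>S / 4\<close>.\<close>

lemma second_fourth_moment_pointwise: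
  fixes X Y S \<beta> :: real
  assumes S: "0 < S" and \<beta>: "0 \<le> \<beta>" "Y < X\<^sup>2 \<Longrightarrow> 1 \<le> \<beta>" and Y: "0 \<le> Y"
  shows "X\<^sup>2 \<le> S / 2 + 1 / (36 * S) * X ^ 4 + 9 * S * \<beta> + 18 * Y"
proof (cases "X\<^sup>2 \<le> S / 2")
  case True
  have "0 \<le> 1 / (36 * S) * X ^ 4" "0 \<le> 9 * S * \<beta>" using S \<beta> by simp_all
  with True Y show ?thesis by linarith
next
  case False
  have "0 \<le> (X\<^sup>2 - 18 * S)\<^sup>2 / (36 * S)" using S by simp
  also have "\<dots> = 1 / (36 * S) * X ^ 4 + 9 * S - X\<^sup>2"
    using S by (simp add: field_simps power2_diff) (simp add: power2_eq_square power4_eq_xxxx algebra_simps)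
  finally have *: "X\<^sup>2 \<le> 1 / (36 * S) * X ^ 4 + 9 * S" by simp
  show ?thesis
  proof (cases "Y < X\<^sup>2")
    case True
    have "9 * S \<le> 9 * S * \<beta>" using S \<beta>(2)[OF True] by simp
    with * S Y show ?thesis by linarith
  next
    case F: False
    have "0 \<le> 1 / (36 * S) * X ^ 4" "0 \<le> 9 * S * \<beta>" using S \<beta> by simp_all
    with F False S show ?thesis by linarith
  qed
qed

text \<open>A Paley--Zygmund argument for the Gaussian chaos \<open>\<Sum>i j. y i * z j * G j i\<close> of order two.\<close>

lemma gauss_bilinear_dominates:
  fixes G :: "'j \<Rightarrow> 'i \<Rightarrow> real"
  assumes fin: "finite I" "finite J" and M: "0 \<le> M"
    and S: "200 * M\<^sup>2 * (\<Sum>j\<in>J. (V j)\<^sup>2) < (\<Sum>j\<in>J. \<Sum>i\<in>I. (G j i)\<^sup>2)"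
  shows "ennreal (1 / 60) \<le> (\<integral>\<^sup>+z. \<integral>\<^sup>+y. (if M * \<bar>\<Sum>j\<in>J. z j * V j\<bar> < \<bar>\<Sum>i\<in>I. y i * (\<Sum>j\<in>J. z j * G j i)\<bar>
      then 1 else 0) \<partial>gauss I \<partial>gauss J)"
proof -
  interpret I: prob_space "gauss I" by (rule prob_space_gauss)
  interpret J: prob_space "gauss J" by (rule prob_space_gauss)
  define S where "S = (\<Sum>j\<in>J. \<Sum>i\<in>I. (G j i)\<^sup>2)"
  let ?v = "\<Sum>j\<in>J. (V j)\<^sup>2"
  let ?X = "\<lambda>z y. \<Sum>i\<in>I. y i * (\<Sum>j\<in>J. z j * G j i)"
  let ?Y = "\<lambda>z. \<Sum>j\<in>J. z j * V j"
  let ?\<beta> = "\<lambda>z y. if M * \<bar>?Y z\<bar> < \<bar>?X z y\<bar> then 1 else 0 :: real"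
  have v: "0 \<le> ?v" by (rule sum_nonneg) simp
  have S0: "0 < S" using S v unfolding S_def by (smt (verit) mult_nonneg_nonneg zero_le_power2)
  have [measurable]: "(\<lambda>(z, y). ?\<beta> z y) \<in> borel_measurable (gauss J \<Otimes>\<^sub>M gauss I)"
    by measurable
  define P where "P = (\<integral>\<^sup>+z. \<integral>\<^sup>+y. ennreal (?\<beta> z y) \<partial>gauss I \<partial>gauss J)"
  have "P \<le> (\<integral>\<^sup>+z. \<integral>\<^sup>+y. 1 \<partial>gauss I \<partial>gauss J)"
    unfolding P_def by (intro nn_integral_mono) auto
  then have P1: "P \<le> 1" by (simp add: I.emeasure_space_1 J.emeasure_space_1)
  have "ennreal S = (\<integral>\<^sup>+z. \<integral>\<^sup>+y. ennreal ((?X z y)\<^sup>2) \<partial>gauss I \<partial>gauss J)"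
    unfolding S_def by (rule gauss_bilinear_moments(1)[OF fin, symmetric])
  also have "\<dots> \<le> (\<integral>\<^sup>+z. \<integral>\<^sup>+y. ennreal (S / 2) + ennreal (1 / (36 * S)) * ennreal (?X z y ^ 4)
      + ennreal (9 * S) * ennreal (?\<beta> z y) + ennreal (18 * M\<^sup>2) * ennreal ((?Y z)\<^sup>2) \<partial>gauss I \<partial>gauss J)"
  proof (rule nn_integral_mono, rule nn_integral_mono)
    fix z y
    have "(?X z y)\<^sup>2 \<le> S / 2 + 1 / (36 * S) * ?X z y ^ 4 + 9 * S * ?\<beta> z y + 18 * (M * \<bar>?Y z\<bar>)\<^sup>2"
    proof (rule second_fourth_moment_pointwise[OF S0])
      assume "(M * \<bar>?Y z\<bar>)\<^sup>2 < (?X z y)\<^sup>2"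
      then have "(M * \<bar>?Y z\<bar>)\<^sup>2 < \<bar>?X z y\<bar>\<^sup>2" by simp
      then have "M * \<bar>?Y z\<bar> < \<bar>?X z y\<bar>" by (rule power2_less_imp_less) simp
      then show "1 \<le> ?\<beta> z y" by simp
    qed auto
    then have "ennreal ((?X z y)\<^sup>2)
        \<le> ennreal (S / 2 + 1 / (36 * S) * ?X z y ^ 4 + 9 * S * ?\<beta> z y + 18 * M\<^sup>2 * (?Y z)\<^sup>2)"
      by (intro ennreal_leI) (simp add: power_mult_distrib mult.assoc)
    also have "\<dots> = ennreal (S / 2) + ennreal (1 / (36 * S)) * ennreal (?X z y ^ 4)
        + ennreal (9 * S) * ennreal (?\<beta> z y) + ennreal (18 * M\<^sup>2) * ennreal ((?Y z)\<^sup>2)"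
      using S0 by (simp only: ennreal_plus ennreal_mult' zero_le_power2 zero_le_even_power mult_nonneg_nonneg
          add_nonneg_nonneg less_imp_le divide_nonneg_nonneg zero_le_numeral zero_le_one even_numeral
          if_split order_refl simp_thms)
    finally show "ennreal ((?X z y)\<^sup>2) \<le> \<dots>" .
  qed
  also have "\<dots> = ennreal (S / 2)
      + ennreal (1 / (36 * S)) * (\<integral>\<^sup>+z. \<integral>\<^sup>+y. ennreal (?X z y ^ 4) \<partial>gauss I \<partial>gauss J)
      + ennreal (9 * S) * P + ennreal (18 * M\<^sup>2) * (\<integral>\<^sup>+z. ennreal ((?Y z)\<^sup>2) \<partial>gauss J)"
    unfolding P_def
    by (simp add: nn_integral_add nn_integral_cmult I.emeasure_space_1 J.emeasure_space_1)
  also have "\<dots> \<le> ennreal (S / 2) + ennreal (1 / (36 * S)) * ennreal (9 * S\<^sup>2)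
      + ennreal (9 * S) * P + ennreal (18 * M\<^sup>2) * ennreal ?v"
    unfolding gauss_linear_moments(1)[OF fin(2)]
    by (intro add_mono mult_left_mono order_refl gauss_bilinear_moments(2)[OF fin, of G, folded S_def]) auto
  finally have main: "ennreal S \<le> ennreal (S / 2) + ennreal (1 / (36 * S)) * ennreal (9 * S\<^sup>2)
      + ennreal (9 * S) * P + ennreal (18 * M\<^sup>2) * ennreal ?v" .
  obtain p where p: "0 \<le> p" "P = ennreal p" using P1 by (cases P) (auto simp: top_unique)
  have "ennreal S \<le> ennreal (S / 2 + 1 / (36 * S) * (9 * S\<^sup>2) + 9 * S * p + 18 * M\<^sup>2 * ?v)"
    using main S0 p(1) v unfolding p(2)
    by (simp only: ennreal_plus ennreal_mult' zero_le_power2 mult_nonneg_nonneg add_nonneg_nonneg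
        less_imp_le divide_nonneg_nonneg zero_le_numeral zero_le_one)
  then have "S \<le> S / 2 + 1 / (36 * S) * (9 * S\<^sup>2) + 9 * S * p + 18 * M\<^sup>2 * ?v"
    using S0 p v by (subst (asm) ennreal_le_iff) auto
  moreover have "1 / (36 * S) * (9 * S\<^sup>2) = S / 4" using S0 by (simp add: power2_eq_square)
  moreover have "18 * M\<^sup>2 * ?v \<le> 9 / 100 * S" using S unfolding S_def by linarith
  \<comment> \<open>The fraction of \<open>S\<close> that remains is
    \<open>1 - 1/2 - 1/4 - 9/100\<close>, the last term coming from the factor 200 in the
    hypothesis; and \<open>16 / 900\<close> exceeds \<open>1 / 60\<close>.\<close>
  ultimately have "S * (16 / 100) \<le> S * (9 * p)" by linarith
  then have "1 / 60 \<le> p" using S0 by (simp add: mult_le_cancel_left_pos)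
  then have "ennreal (1 / 60) \<le> P" unfolding p by (rule ennreal_leI)
  then show ?thesis unfolding P_def by (simp add: if_distrib[of ennreal] cong: if_cong)
qed

text \<open>Gaussian combinations of the \<open>v j\<close> with weights \<open>z\<close> reduce
  vectors to scalars. At a point \<open>x\<close> of the exceptional set, the event of
  \<open>directional_anticoncentration\<close> has probability at least 1/60 over
  \<open>(z, y)\<close>, while for each fixed \<open>z\<close> its probability over
  \<open>(x, y)\<close> is at most \<open>12 * m\<^sup>2 / M\<close>; Fubini gives
  \<open>60 * 12 = 720\<close>.\<close>

lemma gradient_anticoncentration:
  assumes fin: "finite I" "finite J" and v: "\<And>j. j \<in> J \<Longrightarrow> poly_fun I m (v j)" and M: "0 < M"
  shows "emeasure (gauss I)
      {x \<in> space (gauss I). 200 * M\<^sup>2 * (\<Sum>j\<in>J. (v j x)\<^sup>2) < (\<Sum>j\<in>J. \<Sum>i\<in>I. (pd i (v j) x)\<^sup>2)}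
    \<le> ennreal (720 * (real m)\<^sup>2 / M)" (is "emeasure _ ?B \<le> _")
proof -
  interpret I: prob_space "gauss I" by (rule prob_space_gauss)
  interpret J: prob_space "gauss J" by (rule prob_space_gauss)
  interpret II: pair_prob_space "gauss I" "gauss I" ..
  interpret JI: pair_sigma_finite "gauss J" "gauss I" ..
  have m[measurable]: "j \<in> J \<Longrightarrow> v j \<in> borel_measurable (gauss I)"
    "j \<in> J \<Longrightarrow> i \<in> I \<Longrightarrow> pd i (v j) \<in> borel_measurable (gauss I)" for i j
    using measurable_poly_fun[OF v] measurable_poly_fun[OF poly_fun_pd[OF fin(1) v]] by auto
  let ?Q = "\<lambda>z x y. M * \<bar>\<Sum>j\<in>J. z j * v j x\<bar> < \<bar>\<Sum>i\<in>I. y i * (\<Sum>j\<in>J. z j * pd i (v j) x)\<bar>"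
  let ?\<beta> = "\<lambda>z x y. (if ?Q z x y then 1 else 0 :: ennreal)"
  have B[measurable]: "?B \<in> sets (gauss I)" by measurable
  have "ennreal (1 / 60) * emeasure (gauss I) ?B = (\<integral>\<^sup>+x. ennreal (1 / 60) * indicator ?B x \<partial>gauss I)"
    by (rule nn_integral_cmult_indicator[symmetric]) measurable
  also have "\<dots> \<le> (\<integral>\<^sup>+x. \<integral>\<^sup>+z. \<integral>\<^sup>+y. ?\<beta> z x y \<partial>gauss I \<partial>gauss J \<partial>gauss I)"
  proof (rule nn_integral_mono)
    fix x
    show "ennreal (1 / 60) * indicator ?B x \<le> (\<integral>\<^sup>+z. \<integral>\<^sup>+y. ?\<beta> z x y \<partial>gauss I \<partial>gauss J)"
    proof (cases "x \<in> ?B")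
      case True
      then have "200 * M\<^sup>2 * (\<Sum>j\<in>J. (v j x)\<^sup>2) < (\<Sum>j\<in>J. \<Sum>i\<in>I. (pd i (v j) x)\<^sup>2)" by simp
      from gauss_bilinear_dominates[OF fin _ this] M True show ?thesis by simp
    qed simp
  qed
  also have "\<dots> = (\<integral>\<^sup>+z. \<integral>\<^sup>+x. \<integral>\<^sup>+y. ?\<beta> z x y \<partial>gauss I \<partial>gauss I \<partial>gauss J)"
    by (rule JI.Fubini') measurable
  also have "\<dots> \<le> (\<integral>\<^sup>+z. ennreal (12 * (real m)\<^sup>2 / M) \<partial>gauss J)"
  proof (rule nn_integral_mono)
    fix z
    let ?w = "\<lambda>x. \<Sum>j\<in>J. z j * v j x"
    have w: "poly_fun I m ?w" by (intro poly_fun_sum poly_fun_cmult v fin)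
    have pdw: "pd i ?w x = (\<Sum>j\<in>J. z j * pd i (v j) x)" if "i \<in> I" for i x
      by (rule pd_sum[OF fin v that])
    let ?E = "{\<omega> \<in> space (gauss I \<Otimes>\<^sub>M gauss I). M * \<bar>?w (fst \<omega>)\<bar> < \<bar>\<Sum>i\<in>I. snd \<omega> i * pd i ?w (fst \<omega>)\<bar>}"
    have Eeq: "?E = {\<omega> \<in> space (gauss I \<Otimes>\<^sub>M gauss I). ?Q z (fst \<omega>) (snd \<omega>)}" by (simp add: pdw)
    have [measurable]: "?E \<in> sets (gauss I \<Otimes>\<^sub>M gauss I)" unfolding Eeq by measurable
    have "(\<integral>\<^sup>+x. \<integral>\<^sup>+y. ?\<beta> z x y \<partial>gauss I \<partial>gauss I) = (\<integral>\<^sup>+x. \<integral>\<^sup>+y. indicator ?E (x, y) \<partial>gauss I \<partial>gauss I)"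
      unfolding Eeq by (intro nn_integral_cong) (auto simp: indicator_def space_pair_measure)
    also have "\<dots> = emeasure (gauss I \<Otimes>\<^sub>M gauss I) ?E"
      by (subst I.nn_integral_fst) auto
    also have "\<dots> \<le> ennreal (12 * (real m)\<^sup>2 / M)"
      by (rule directional_anticoncentration[OF fin(1) w M])
    finally show "(\<integral>\<^sup>+x. \<integral>\<^sup>+y. ?\<beta> z x y \<partial>gauss I \<partial>gauss I) \<le> ennreal (12 * (real m)\<^sup>2 / M)" .
  qed
  also have "\<dots> = ennreal (12 * (real m)\<^sup>2 / M)" by (simp add: J.emeasure_space_1)
  finally have "ennreal 60 * (ennreal (1 / 60) * emeasure (gauss I) ?B) \<le> ennreal 60 * ennreal (12 * (real m)\<^sup>2 / M)"
    by (rule mult_left_mono) simp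
  moreover have "ennreal 60 * (ennreal (1 / 60) * emeasure (gauss I) ?B) = emeasure (gauss I) ?B"
    unfolding mult.assoc[symmetric] by (subst ennreal_mult[symmetric]) auto
  moreover have "ennreal 60 * ennreal (12 * (real m)\<^sup>2 / M) = ennreal (720 * (real m)\<^sup>2 / M)"
    using M by (subst ennreal_mult[symmetric]) auto
  ultimately show ?thesis by simp
qed

section \<open>Stability of the sign\<close>

text \<open>Index words rather than multisets: a mixed derivative occurs once for every order of
  differentiation, and a word of length \<open>k + 1\<close> is a word of length \<open>k\<close>
  with one more letter in front.\<close>

definition partials :: "'i set \<Rightarrow> nat \<Rightarrow> 'i list set" where
  "partials I k = {l. set l \<subseteq> I \<and> length l = k}"

text \<open>The squared Euclidean norm of the derivative tensor of order \<open>k\<close>.\<close>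

definition sq_partials :: "'i set \<Rightarrow> nat \<Rightarrow> (('i \<Rightarrow> real) \<Rightarrow> real) \<Rightarrow> ('i \<Rightarrow> real) \<Rightarrow> real" where
  "sq_partials I k p x = (\<Sum>l\<in>partials I k. (foldr pd l p x)\<^sup>2)"

lemma finite_partials: "finite I \<Longrightarrow> finite (partials I k)"
  unfolding partials_def by (rule finite_lists_length_eq)

lemma partials_0: "partials I 0 = {[]}" by (auto simp: partials_def)

lemma sum_partials_Suc:
  "(\<Sum>l\<in>partials I (Suc k). f l) = (\<Sum>l\<in>partials I k. \<Sum>i\<in>I. f (i # l))"
proof -
  have "partials I (Suc k) = (\<lambda>(l, i). i # l) ` (partials I k \<times> I)"
    by (auto simp: partials_def image_def length_Suc_conv)
  moreover have "inj_on (\<lambda>(l, i). i # l) (partials I k \<times> I)" by (auto simp: inj_on_def)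
  ultimately show ?thesis by (simp add: sum.reindex sum.cartesian_product case_prod_unfold)
qed

lemma poly_fun_foldr_pd:
  assumes "finite I" "poly_fun I d p" "set l \<subseteq> I"
  shows "poly_fun I (d - length l) (foldr pd l p)"
  using assms(3)
proof (induction l)
  case (Cons i l)
  then have "poly_fun I (d - length l - 1) (pd i (foldr pd l p))"
    using assms(1) by (intro poly_fun_pd) auto
  then show ?case by simp
qed (simp add: assms)

lemma sq_partials_0: "sq_partials I 0 p x = (p x)\<^sup>2"
  by (simp add: sq_partials_def partials_0)

lemma measurable_sq_partials:
  assumes "finite I" "poly_fun I d p"
  shows "sq_partials I k p \<in> borel_measurable (gauss I)"
proof -
  have "foldr pd l p \<in> borel_measurable (gauss I)" if "l \<in> partials I k" for l
    using that by (intro measurable_poly_fun[OF poly_fun_foldr_pd[OF assms]]) (auto simp: partials_def)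
  then show ?thesis unfolding sq_partials_def[abs_def] by measurable
qed

text \<open>The derivatives of order \<open>k\<close> form a vector whose gradients make up the
  tensor of order \<open>k + 1\<close>, so \<open>gradient_anticoncentration\<close> applies at each
  order; a union bound over \<open>k < d\<close> gives the third power of \<open>d\<close>.\<close>

lemma emeasure_large_derivatives:
  assumes I: "finite I" and p: "poly_fun I d p" and M: "0 < M"
  shows "emeasure (gauss I) {x \<in> space (gauss I). \<exists>k<d. 200 * M\<^sup>2 * sq_partials I k p x < sq_partials I (Suc k) p x}
    \<le> ennreal (720 * real d ^ 3 / M)"
proof -
  note [measurable] = measurable_sq_partials[OF I p]
  let ?B = "\<lambda>k. {x \<in> space (gauss I). 200 * M\<^sup>2 * sq_partials I k p x < sq_partials I (Suc k) p x}"
  have B: "emeasure (gauss I) (?B k) \<le> ennreal (720 * (real d)\<^sup>2 / M)" for k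
  proof -
    have "?B k = {x \<in> space (gauss I). 200 * M\<^sup>2 * (\<Sum>l\<in>partials I k. (foldr pd l p x)\<^sup>2)
        < (\<Sum>l\<in>partials I k. \<Sum>i\<in>I. (pd i (foldr pd l p) x)\<^sup>2)}"
      by (simp add: sq_partials_def sum_partials_Suc)
    also have "emeasure (gauss I) \<dots> \<le> ennreal (720 * (real d)\<^sup>2 / M)"
    proof (rule gradient_anticoncentration[OF I finite_partials[OF I] _ M])
      fix l assume "l \<in> partials I k"
      then show "poly_fun I d (foldr pd l p)"
        by (intro poly_fun_mono[OF poly_fun_foldr_pd[OF I p]]) (auto simp: partials_def)
    qed
    finally show ?thesis .
  qed
  have "emeasure (gauss I) {x \<in> space (gauss I). \<exists>k<d. 200 * M\<^sup>2 * sq_partials I k p x < sq_partials I (Suc k) p x}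
      = emeasure (gauss I) (\<Union>k<d. ?B k)"
    by (rule arg_cong[of _ _ "emeasure (gauss I)"]) auto
  also have "\<dots> \<le> (\<Sum>k<d. emeasure (gauss I) (?B k))"
    by (rule emeasure_subadditive_finite) auto
  also have "\<dots> \<le> (\<Sum>k<d. ennreal (720 * (real d)\<^sup>2 / M))" by (rule sum_mono) (rule B)
  also have "\<dots> = ennreal (720 * real d ^ 3 / M)"
  proof -
    have "real d * (720 * (real d)\<^sup>2 / M) = 720 * real d ^ 3 / M"
      by (simp add: power2_eq_square power3_eq_cube)
    then show ?thesis using M by (simp add: ennreal_of_nat_eq_real_of_nat ennreal_mult[symmetric])
  qed
  finally show ?thesis .
qed

text \<open>Both sides are the squared norm of the \<open>k\<close>-th tensor power of
  \<open>h\<close>, which is paired with the derivative tensor in a Taylor term.\<close>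

lemma sum_partials_prod_list:
  fixes h :: "'i \<Rightarrow> real"
  shows "(\<Sum>l\<in>partials I k. (prod_list (map h l))\<^sup>2) = (\<Sum>i\<in>I. (h i)\<^sup>2) ^ k"
proof (induction k)
  case (Suc k)
  have "(\<Sum>l\<in>partials I (Suc k). (prod_list (map h l))\<^sup>2)
      = (\<Sum>l\<in>partials I k. \<Sum>i\<in>I. (h i)\<^sup>2 * (prod_list (map h l))\<^sup>2)"
    by (simp add: sum_partials_Suc power_mult_distrib)
  also have "\<dots> = (\<Sum>i\<in>I. (h i)\<^sup>2) * (\<Sum>l\<in>partials I k. (prod_list (map h l))\<^sup>2)"
    unfolding sum_product by (rule sum.swap)
  finally show ?case by (simp add: Suc)
qed (simp add: partials_0)

text \<open>Taylor expansion at \<open>z\<close>: the term of order \<open>k\<close> is at most \<open>2^-k * \<bar>p z\<bar>\<close>.\<close>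

lemma poly_fun_sign_stable:
  assumes I: "finite I" and p: "poly_fun I d p" and B: "0 \<le> B"
    and good: "\<And>k. k < d \<Longrightarrow> sq_partials I (Suc k) p z \<le> B * sq_partials I k p z"
    and h: "B * (\<Sum>i\<in>I. (h i)\<^sup>2) \<le> 1 / 4"
  shows "0 \<le> p (\<lambda>i. z i + h i) \<longleftrightarrow> 0 \<le> p z"
proof -
  let ?z = "\<lambda>s i. z i + s * h i"
  \<comment> \<open>This is the derivative of order \<open>k\<close> of \<open>p\<close> along the
    line \<open>s \<mapsto> z + s * h\<close>, written as a pairing of two tensors.\<close>
  define D where "D k s = (\<Sum>l\<in>partials I k. prod_list (map h l) * foldr pd l p (?z s))" for k and s :: real
  have der: "(D k has_real_derivative D (Suc k) s) (at s)" for k s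
  proof -
    have "((\<lambda>s. prod_list (map h l) * foldr pd l p (?z s)) has_real_derivative
        prod_list (map h l) * (\<Sum>i\<in>I. h i * pd i (foldr pd l p) (?z s))) (at s)" if "l \<in> partials I k" for l
      using that
      by (intro DERIV_cmult poly_fun_chain_rule[OF I poly_fun_foldr_pd[OF I p]])
        (auto simp: partials_def intro!: derivative_eq_intros)
    then have "(D k has_real_derivative
        (\<Sum>l\<in>partials I k. prod_list (map h l) * (\<Sum>i\<in>I. h i * pd i (foldr pd l p) (?z s)))) (at s)"
      unfolding D_def[abs_def] by (rule DERIV_sum)
    also have "(\<Sum>l\<in>partials I k. prod_list (map h l) * (\<Sum>i\<in>I. h i * pd i (foldr pd l p) (?z s))) = D (Suc k) s"
      unfolding D_def sum_partials_Suc sum_distrib_left by (simp add: ac_simps)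
    finally show ?thesis .
  qed
  \<comment> \<open>The derivatives of order \<open>d\<close> have degree 0, so the remainder of
    order \<open>d + 1\<close> vanishes and Taylor's formula is exact.\<close>
  have zero: "D (Suc d) s = 0" for s
  proof -
    have "pd i (foldr pd l p) (?z s) = 0" if "l \<in> partials I d" "i \<in> I" for l i
      using that poly_fun_foldr_pd[OF I p, of l] by (intro pd_degree_0[OF I, of 0]) (auto simp: partials_def)
    then show ?thesis unfolding D_def sum_partials_Suc by simp
  qed
  obtain t where "D 0 1 = (\<Sum>m<Suc d. D m 0 / fact m * 1 ^ m) + D (Suc d) t / fact (Suc d) * 1 ^ Suc d"
    using Maclaurin_all_le[of D "D 0" 1 "Suc d"] der by blast
  then have "p (?z 1) = (\<Sum>m<Suc d. D m 0 / fact m)"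
    by (simp add: zero del: sum.lessThan_Suc) (simp add: D_def partials_0)
  also have "\<dots> = p z + (\<Sum>m<d. D (Suc m) 0 / fact (Suc m))"
    by (subst sum.lessThan_Suc_shift) (simp add: D_def partials_0)
  finally have taylor: "p (?z 1) - p z = (\<Sum>m<d. D (Suc m) 0 / fact (Suc m))" by simp
  have sq: "sq_partials I k p z \<le> B ^ k * (p z)\<^sup>2" if "k \<le> d" for k
    using that
  proof (induction k)
    case (Suc k)
    have "sq_partials I (Suc k) p z \<le> B * sq_partials I k p z" using good Suc.prems by simp
    also have "\<dots> \<le> B * (B ^ k * (p z)\<^sup>2)" using Suc B by (intro mult_left_mono) auto
    finally show ?case by simp
  qed (simp add: sq_partials_0)
  have bound: "\<bar>D k 0 / fact k\<bar> \<le> (1 / 2) ^ k * \<bar>p z\<bar>" if "k \<le> d" for k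
  proof -
    let ?H = "\<Sum>i\<in>I. (h i)\<^sup>2"
    have H: "0 \<le> ?H" by (simp add: sum_nonneg)
    have "(D k 0)\<^sup>2 \<le> (\<Sum>l\<in>partials I k. (prod_list (map h l))\<^sup>2) * (\<Sum>l\<in>partials I k. (foldr pd l p (?z 0))\<^sup>2)"
      unfolding D_def by (rule Cauchy_Schwarz_ineq_sum)
    also have "\<dots> = ?H ^ k * sq_partials I k p z" by (simp add: sum_partials_prod_list sq_partials_def)
    also have "\<dots> \<le> ?H ^ k * (B ^ k * (p z)\<^sup>2)" using sq[OF that] H by (intro mult_left_mono) auto
    also have "\<dots> = (B * ?H) ^ k * (p z)\<^sup>2" by (simp add: power_mult_distrib)
    also have "\<dots> \<le> (1 / 4) ^ k * (p z)\<^sup>2" using h B H by (intro mult_right_mono power_mono) auto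
    also have "(1 / 4 :: real) ^ k = ((1 / 2) ^ k)\<^sup>2"
      by (simp add: power2_eq_square flip: power_mult_distrib)
    finally have "\<bar>D k 0\<bar>\<^sup>2 \<le> ((1 / 2) ^ k * \<bar>p z\<bar>)\<^sup>2" by (simp add: power_mult_distrib)
    then have "\<bar>D k 0\<bar> \<le> (1 / 2) ^ k * \<bar>p z\<bar>" by (rule power2_le_imp_le) simp
    moreover have "\<bar>D k 0 / fact k\<bar> \<le> \<bar>D k 0\<bar>"
      using mult_left_mono[OF fact_ge_1, of "\<bar>D k 0\<bar>" k] by (simp add: divide_le_eq)
    ultimately show ?thesis by linarith
  qed
  have "\<bar>p (?z 1) - p z\<bar> \<le> (\<Sum>m<d. \<bar>D (Suc m) 0 / fact (Suc m)\<bar>)" unfolding taylor by (rule sum_abs)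
  also have "\<dots> \<le> (\<Sum>m<d. (1 / 2) ^ Suc m * \<bar>p z\<bar>)" by (intro sum_mono bound) auto
  also have "\<dots> = (1 - (1 / 2) ^ d) * \<bar>p z\<bar>"
  proof -
    have "(\<Sum>m<d. (1 / 2 :: real) ^ Suc m) = 1 - (1 / 2) ^ d" by (induction d) auto
    then show ?thesis by (simp only: sum_distrib_right[symmetric])
  qed
  finally have diff: "\<bar>p (?z 1) - p z\<bar> \<le> (1 - (1 / 2) ^ d) * \<bar>p z\<bar>" .
  show ?thesis
  \<comment> \<open>The finite geometric sum stays strictly below 1, so \<open>p\<close> changes by
    less than \<open>\<bar>p z\<bar>\<close>; if \<open>p z = 0\<close> it does not change at
    all.\<close>
  proof (cases "p z = 0")
    case True
    then show ?thesis using diff by simp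
  next
    case False
    have "(1 - (1 / 2) ^ d) * \<bar>p z\<bar> < \<bar>p z\<bar>" using False by simp
    with diff have "\<bar>p (?z 1) - p z\<bar> < \<bar>p z\<bar>" by linarith
    then show ?thesis by (simp, linarith)
  qed
qed

section \<open>Gaussian restrictions\<close>

lemma borel_measurable_sign01 [measurable]: "sign01 \<in> borel_measurable borel"
  unfolding sign01_def[abs_def] by measurable

text \<open>The point \<open>Z x y\<close> is a component of a rotated Gaussian pair, hence itself
  Gaussian and in \<open>Bad\<close> with probability at most \<open>\<delta> / 2\<close>. Markov's
  inequality at level 1/2 then bounds the measure of the exceptional \<open>x\<close> by
  \<open>\<delta>\<close>.\<close>

lemma gauss_restriction_good:
  assumes I: "finite I" and [measurable]: "Bad \<in> sets (gauss I)"
    and Bad: "emeasure (gauss I) Bad \<le> ennreal (\<delta> / 2)" and \<delta>: "0 < \<delta>" and lam: "0 < lam" "lam < 1"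
  defines "Z \<equiv> \<lambda>x y. \<lambda>i\<in>I. sqrt (1 - lam) * x i + sqrt lam * y i"
  shows "\<exists>X \<in> sets (gauss I). 1 - \<delta> \<le> measure (gauss I) X \<and>
    (\<forall>x\<in>X. measure (gauss I) {y \<in> space (gauss I). Z x y \<in> Bad} < 1 / 2)"
proof -
  interpret I: prob_space "gauss I" by (rule prob_space_gauss)
  interpret II: pair_prob_space "gauss I" "gauss I" ..
  have Z: "Z x y = fst (gauss_rotate I (sqrt (1 - lam)) (sqrt lam) (x, y))" for x y
    by (simp add: Z_def gauss_rotate_def)
  have [measurable]: "(\<lambda>(x, y). Z x y) \<in> gauss I \<Otimes>\<^sub>M gauss I \<rightarrow>\<^sub>M gauss I"
    unfolding Z by measurable
  let ?u = "\<lambda>x. \<integral>\<^sup>+y. indicator Bad (Z x y) \<partial>gauss I"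
  have u: "?u x = emeasure (gauss I) {y \<in> space (gauss I). Z x y \<in> Bad}" if x: "x \<in> space (gauss I)" for x
  proof -
    have [measurable]: "Z x \<in> gauss I \<rightarrow>\<^sub>M gauss I" using x by measurable
    have "?u x = (\<integral>\<^sup>+y. indicator {y \<in> space (gauss I). Z x y \<in> Bad} y \<partial>gauss I)"
      by (intro nn_integral_cong) (auto simp: indicator_def)
    then show ?thesis by simp
  qed
  have "(\<integral>\<^sup>+x. ?u x \<partial>gauss I)
      = (\<integral>\<^sup>+\<omega>. indicator Bad (fst (gauss_rotate I (sqrt (1 - lam)) (sqrt lam) \<omega>)) \<partial>(gauss I \<Otimes>\<^sub>M gauss I))"
    unfolding Z by (subst I.nn_integral_fst[symmetric]) auto
  also have "\<dots> = (\<integral>\<^sup>+\<omega>. indicator Bad (fst \<omega>) \<partial>(gauss I \<Otimes>\<^sub>M gauss I))"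
  proof (rule nn_integral_gauss_rotate[OF I])
    show "(sqrt (1 - lam))\<^sup>2 + (sqrt lam)\<^sup>2 = 1" using lam by simp
    have "0 \<le> sqrt (1 - lam)" using lam by simp
    then show "sqrt (1 - lam) \<noteq> - 1" by linarith
  qed measurable
  also have "\<dots> = emeasure (gauss I) Bad"
    by (subst I.nn_integral_fst[symmetric]) (auto simp: I.emeasure_space_1)
  finally have int: "(\<integral>\<^sup>+x. ?u x \<partial>gauss I) \<le> ennreal (\<delta> / 2)" using Bad by simp
  define X where "X = {x \<in> space (gauss I). \<not> 1 \<le> 2 * ?u x}"
  have [measurable]: "X \<in> sets (gauss I)" unfolding X_def by measurable
  have "emeasure (gauss I) (space (gauss I) - X) = emeasure (gauss I) {x \<in> space (gauss I). 1 \<le> 2 * ?u x}"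
    by (rule arg_cong[of _ _ "emeasure (gauss I)"]) (auto simp: X_def)
  also have "\<dots> \<le> 2 * (\<integral>\<^sup>+x. ?u x * indicator (space (gauss I)) x \<partial>gauss I)"
    by (rule nn_integral_Markov_inequality) auto
  also have "(\<integral>\<^sup>+x. ?u x * indicator (space (gauss I)) x \<partial>gauss I) = (\<integral>\<^sup>+x. ?u x \<partial>gauss I)"
    by (intro nn_integral_cong) auto
  also have "2 * \<dots> \<le> 2 * ennreal (\<delta> / 2)" by (intro mult_left_mono int) auto
  also have "\<dots> = ennreal \<delta>" using \<delta> by (simp flip: ennreal_mult ennreal_numeral)
  finally have "measure (gauss I) (space (gauss I) - X) \<le> \<delta>"
    using \<delta> by (simp add: I.emeasure_eq_measure)
  then have "1 - \<delta> \<le> measure (gauss I) X" by (simp add: I.prob_compl)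
  moreover have "measure (gauss I) {y \<in> space (gauss I). Z x y \<in> Bad} < 1 / 2" if "x \<in> X" for x
  proof -
    let ?m = "measure (gauss I) {y \<in> space (gauss I). Z x y \<in> Bad}"
    have "\<not> ennreal 1 \<le> ennreal (2 * ?m)"
      using that u[of x] unfolding X_def I.emeasure_eq_measure by (auto simp: ennreal_mult)
    then show ?thesis by (subst (asm) ennreal_le_iff) auto
  qed
  ultimately show ?thesis by (intro bexI[of _ X]) auto
qed

text \<open>The points satisfying the derivative bounds have measure at least 1/2, so one of the two signs is taken
  by a quarter of them; points with the other sign are far from these.\<close>

lemma gauss_sign_concentrated:
  fixes p :: "('i \<Rightarrow> real) \<Rightarrow> real"
  assumes I: "finite I" and p: "poly_fun I d p" and B: "0 \<le> B" and lam: "0 < lam"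
    and x: "x \<in> space (gauss I)"
    and s: "B * (lam * s) \<le> 1 / 4"
  defines "Z \<equiv> \<lambda>x y. \<lambda>i\<in>I. sqrt (1 - lam) * x i + sqrt lam * y i"
  defines "Bad \<equiv> {z \<in> space (gauss I). \<exists>k<d. B * sq_partials I k p z < sq_partials I (Suc k) p z}"
  assumes good: "measure (gauss I) {y \<in> space (gauss I). Z x y \<in> Bad} < 1 / 2"
  shows "\<exists>c. measure (gauss I) {y \<in> space (gauss I). (0 \<le> p (Z x y)) \<noteq> c} \<le> 4 * exp (- s / 4)"
proof -
  interpret I: prob_space "gauss I" by (rule prob_space_gauss)
  have [measurable]: "Z x \<in> gauss I \<rightarrow>\<^sub>M gauss I" unfolding Z_def by measurable
  note [measurable] = measurable_sq_partials[OF I p] measurable_poly_fun[OF p]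
  have [measurable]: "Bad \<in> sets (gauss I)" unfolding Bad_def by measurable
  define A where "A c = {y \<in> space (gauss I). Z x y \<notin> Bad \<and> (0 \<le> p (Z x y)) = c}" for c
  define N where "N c = {y \<in> space (gauss I). (0 \<le> p (Z x y)) \<noteq> c}" for c
  have [measurable]: "A c \<in> sets (gauss I)" "N c \<in> sets (gauss I)" for c
    unfolding A_def N_def by measurable
  let ?Q = "{y \<in> space (gauss I). Z x y \<in> Bad}"
  have Zs: "Z x y \<in> space (gauss I)" for y by (simp add: Z_def space_PiM)
  have [measurable]: "?Q \<in> sets (gauss I)" by measurable
  have "space (gauss I) = (A True \<union> A False) \<union> ?Q" by (auto simp: A_def)
  then have "1 = measure (gauss I) ((A True \<union> A False) \<union> ?Q)" using I.prob_space by metis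
  also have "\<dots> \<le> measure (gauss I) (A True \<union> A False) + measure (gauss I) ?Q"
    by (rule measure_Un_le) measurable
  also have "measure (gauss I) (A True \<union> A False) \<le> measure (gauss I) (A True) + measure (gauss I) (A False)"
    by (rule measure_Un_le) measurable
  finally have "1 / 4 \<le> measure (gauss I) (A True) \<or> 1 / 4 \<le> measure (gauss I) (A False)"
    using good by linarith
  then obtain c where c: "1 / 4 \<le> measure (gauss I) (A c)" by blast
  have "measure (gauss I) (A c) * measure (gauss I) (N c) \<le> exp (- s / 4)"
  proof (rule gauss_separated_sets[OF I])
    fix a b assume a: "a \<in> A c" and b: "b \<in> N c"
    show "s \<le> (\<Sum>i\<in>I. (a i - b i)\<^sup>2)"
    proof (rule ccontr)
      assume near: "\<not> s \<le> (\<Sum>i\<in>I. (a i - b i)\<^sup>2)"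
      \<comment> \<open>The displacement from \<open>Z x a\<close> to \<open>Z x b\<close>: the
        factor \<open>sqrt lam\<close> shrinks a squared distance below \<open>s\<close> to one
        below \<open>lam * s\<close>, inside the radius of stability.\<close>
      define h where "h i = sqrt lam * (b i - a i)" for i
      have "(\<Sum>i\<in>I. (h i)\<^sup>2) = lam * (\<Sum>i\<in>I. (a i - b i)\<^sup>2)"
        using lam by (simp add: h_def power_mult_distrib sum_distrib_left power2_commute)
      also have "\<dots> \<le> lam * s" using near lam by (intro mult_left_mono) auto
      finally have "B * (\<Sum>i\<in>I. (h i)\<^sup>2) \<le> B * (lam * s)" using B by (rule mult_left_mono)
      with s have h: "B * (\<Sum>i\<in>I. (h i)\<^sup>2) \<le> 1 / 4" by linarith
      \<comment> \<open>Outside \<open>I\<close> the two points may differ, since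
        \<open>Z x b\<close> is \<open>undefined\<close> there; \<open>poly_fun_cong\<close>
        compares them on \<open>I\<close> only.\<close>
      have "p (\<lambda>i. Z x a i + h i) = p (Z x b)"
        by (rule poly_fun_cong[OF p]) (simp add: Z_def h_def algebra_simps)
      moreover have "0 \<le> p (\<lambda>i. Z x a i + h i) \<longleftrightarrow> 0 \<le> p (Z x a)"
      proof (rule poly_fun_sign_stable[OF I p B _ h])
        fix k assume "k < d"
        moreover have "Z x a \<notin> Bad" using a by (simp add: A_def)
        ultimately have "\<not> B * sq_partials I k p (Z x a) < sq_partials I (Suc k) p (Z x a)"
          using Zs unfolding Bad_def by blast
        then show "sq_partials I (Suc k) p (Z x a) \<le> B * sq_partials I k p (Z x a)" by linarith
      qed
      ultimately show False using a b by (auto simp: A_def N_def)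
    qed
  qed measurable
  moreover have "1 / 4 * measure (gauss I) (N c) \<le> measure (gauss I) (A c) * measure (gauss I) (N c)"
    using c by (intro mult_right_mono) auto
  ultimately have "measure (gauss I) (N c) \<le> 4 * exp (- s / 4)" by linarith
  then show ?thesis unfolding N_def ..
qed

section \<open>Choice of the constants and assembly\<close>

lemma polynomial_of_degree_le_poly_fun:
  assumes "polynomial_of_degree_le n d p"
  shows "\<exists>q. poly_fun {..<n} d q \<and> (\<forall>x\<in>Rn n. p x = q x)"
proof -
  obtain c where c: "\<forall>x\<in>Rn n. p x = (\<Sum>\<alpha>\<in>multi_exponents n d. c \<alpha> * (\<Prod>i<n. x i ^ \<alpha> i))"
    using assms unfolding polynomial_of_degree_le_def by blast
  have pow: "poly_fun {..<n} (k + e) (\<lambda>x. x i ^ k * q x)" if "poly_fun {..<n} e q" "i < n" for i k e q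
    using that by (induction k) (auto simp: mult.assoc intro: poly_fun_var)
  have mono: "poly_fun {..<n} (\<Sum>i<m. \<alpha> i) (\<lambda>x. \<Prod>i<m. x i ^ \<alpha> i)" if "m \<le> n" for m \<alpha>
    using that
  proof (induction m)
    case (Suc m)
    then show ?case using pow[of "\<Sum>i<m. \<alpha> i" "\<lambda>x. \<Prod>i<m. x i ^ \<alpha> i" m "\<alpha> m"]
      by (simp add: ac_simps)
  qed (simp add: poly_fun_const)
  have "poly_fun {..<n} d (\<lambda>x. \<Sum>\<alpha>\<in>multi_exponents n d. c \<alpha> * (\<Prod>i<n. x i ^ \<alpha> i))"
    by (intro poly_fun_sum finite_multi_exponents poly_fun_cmult poly_fun_mono[OF mono])
      (auto simp: multi_exponents_def)
  with c show ?thesis by blast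
qed

text \<open>The case \<open>\<epsilon> \<le> 1 / 2\<close>, where all constants are fixed. Stability
  up to squared distance \<open>16 * ln (1 / \<epsilon>)\<close> in \<open>y\<close> makes the
  concentration bound \<open>4 * \<epsilon> ^ 4\<close>, which is below
  \<open>\<epsilon>\<close>.\<close>

lemma polynomial_restriction_concentrated:
  fixes p :: "(nat \<Rightarrow> real) \<Rightarrow> real"
  assumes p: "poly_fun {..<n} d p" and d: "0 < d" and \<delta>: "0 < \<delta>" and \<epsilon>: "0 < \<epsilon>" "\<epsilon> \<le> 1 / 2"
    and lam: "0 < lam" "lam < 1" "lam \<le> 1 / 10 ^ 11 * (\<delta>\<^sup>2 / (real d ^ 6 * ln (1 / \<epsilon>)))"
  shows "\<exists>X \<in> sets (std_gaussian n). 1 - \<delta> \<le> measure (std_gaussian n) X \<and>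
    (\<forall>x\<in>X. \<exists>b\<in>{0, 1}. 1 - \<epsilon> < \<P>(y in std_gaussian n.
      sign01 (p (\<lambda>i\<in>{..<n}. sqrt (1 - lam) * x i + sqrt lam * y i)) = b))"
proof -
  let ?I = "{..<n}"
  interpret I: prob_space "gauss ?I" by (rule prob_space_gauss)
  define L where "L = ln (1 / \<epsilon>)"
  have L: "0 < L" using \<epsilon> by (simp add: L_def)
  \<comment> \<open>Chosen so that the exceptional measure \<open>720 * d ^ 3 / M\<close> equals
    \<open>\<delta> / 2\<close>, as \<open>gauss_restriction_good\<close> requires.\<close>
  define M where "M = 1440 * real d ^ 3 / \<delta>"
  define B where "B = 200 * M\<^sup>2"
  have M: "0 < M" using d \<delta> by (simp add: M_def)
  have B: "0 \<le> B" by (simp add: B_def)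
  let ?Z = "\<lambda>x y. \<lambda>i\<in>?I. sqrt (1 - lam) * x i + sqrt lam * y i"
  let ?Bad = "{z \<in> space (gauss ?I). \<exists>k<d. B * sq_partials ?I k p z < sq_partials ?I (Suc k) p z}"
  have "emeasure (gauss ?I) ?Bad \<le> ennreal (720 * real d ^ 3 / M)"
    unfolding B_def using p M by (intro emeasure_large_derivatives) auto
  also have "720 * real d ^ 3 / M = \<delta> / 2" using d by (simp add: M_def)
  finally have Bad: "emeasure (gauss ?I) ?Bad \<le> ennreal (\<delta> / 2)" .
  note [measurable] = measurable_sq_partials[OF finite_lessThan p] measurable_poly_fun[OF p]
  have "?Bad \<in> sets (gauss ?I)" by measurable
  from gauss_restriction_good[OF finite_lessThan this Bad \<delta> lam(1,2)]
  obtain X where X: "X \<in> sets (gauss ?I)" "1 - \<delta> \<le> measure (gauss ?I) X"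
    "\<And>x. x \<in> X \<Longrightarrow> measure (gauss ?I) {y \<in> space (gauss ?I). ?Z x y \<in> ?Bad} < 1 / 2"
    by blast
  \<comment> \<open>This fixes the absolute constant: the powers of \<open>d\<close>,
    \<open>\<delta>\<close> and \<open>L\<close> cancel, leaving a number of about 0.066.\<close>
  have "B * (lam * (16 * L)) \<le> B * ((1 / 10 ^ 11 * (\<delta>\<^sup>2 / (real d ^ 6 * L))) * (16 * L))"
    using lam(3) B L unfolding L_def[symmetric] by (intro mult_left_mono mult_right_mono) auto
  also have "\<dots> = 200 * 1440\<^sup>2 * 16 / 10 ^ 11"
    using d \<delta> L by (simp add: B_def M_def field_simps power2_eq_square flip: power_add)
  also have "\<dots> \<le> 1 / 4" by simp
  finally have s: "B * (lam * (16 * L)) \<le> 1 / 4" .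
  have "\<exists>b\<in>{0, 1}. 1 - \<epsilon> < measure (gauss ?I) {y \<in> space (gauss ?I). sign01 (p (?Z x y)) = b}" if x: "x \<in> X" for x
  proof -
    have xs: "x \<in> space (gauss ?I)" using x X(1) sets.sets_into_space by blast
    obtain c where c: "measure (gauss ?I) {y \<in> space (gauss ?I). (0 \<le> p (?Z x y)) \<noteq> c} \<le> 4 * exp (- (16 * L) / 4)"
      using gauss_sign_concentrated[OF finite_lessThan p B lam(1) xs s X(3)[OF x]] ..
    have "exp (- (16 * L) / 4) = exp (- L) ^ 4" by (simp flip: exp_of_nat_mult)
    also have "exp (- L) = \<epsilon>" using \<epsilon> by (simp add: L_def ln_div)
    finally have e4: "4 * exp (- (16 * L) / 4) = \<epsilon> * (4 * \<epsilon> ^ 3)" by (simp add: power4_eq_xxxx power3_eq_cube)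
    have "\<epsilon> ^ 3 \<le> (1 / 2) ^ 3" using \<epsilon> by (intro power_mono) auto
    then have "\<epsilon> * (4 * \<epsilon> ^ 3) < \<epsilon> * 1" using \<epsilon> by (intro mult_strict_left_mono) (auto simp: power3_eq_cube)
    with c e4 have small: "measure (gauss ?I) {y \<in> space (gauss ?I). (0 \<le> p (?Z x y)) \<noteq> c} < \<epsilon>" by linarith
    have [measurable]: "?Z x \<in> gauss ?I \<rightarrow>\<^sub>M gauss ?I" by measurable
    have "measure (gauss ?I) {y \<in> space (gauss ?I). sign01 (p (?Z x y)) = (if c then 1 else 0)}
        = measure (gauss ?I) (space (gauss ?I) - {y \<in> space (gauss ?I). (0 \<le> p (?Z x y)) \<noteq> c})"
      by (rule arg_cong[of _ _ "measure (gauss ?I)"]) (auto simp: sign01_def)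
    also have "\<dots> = 1 - measure (gauss ?I) {y \<in> space (gauss ?I). (0 \<le> p (?Z x y)) \<noteq> c}"
      by (rule I.prob_compl) measurable
    finally have "1 - \<epsilon> < measure (gauss ?I) {y \<in> space (gauss ?I). sign01 (p (?Z x y)) = (if c then 1 else 0)}"
      using small by linarith
    then show ?thesis by (intro bexI[of _ "if c then 1 else 0"]) auto
  qed
  with X(1,2) show ?thesis unfolding std_gaussian_def by blast
qed

text \<open>One of the two sign probabilities is at least 1/2, hence above
  \<open>1 - \<epsilon>\<close>. This settles every \<open>x\<close> for large
  \<open>\<epsilon>\<close>, where \<open>ln (1 / \<epsilon>)\<close> is below \<open>ln 2\<close>
  and possibly not positive.\<close>

lemma sign_restriction_majority:
  fixes p :: "(nat \<Rightarrow> real) \<Rightarrow> real"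
  assumes p: "poly_fun {..<n} d p" and \<epsilon>: "1 / 2 < \<epsilon>"
  shows "\<exists>b\<in>{0, 1}. 1 - \<epsilon> < \<P>(y in std_gaussian n.
      sign01 (p (\<lambda>i\<in>{..<n}. sqrt (1 - lam) * x i + sqrt lam * y i)) = b)"
proof -
  let ?I = "{..<n}"
  interpret I: prob_space "gauss ?I" by (rule prob_space_gauss)
  let ?Z = "\<lambda>y. \<lambda>i\<in>?I. sqrt (1 - lam) * x i + sqrt lam * y i"
  let ?S = "{y \<in> space (gauss ?I). sign01 (p (?Z y)) = 1}"
  note [measurable] = measurable_poly_fun[OF p]
  have [measurable]: "?Z \<in> gauss ?I \<rightarrow>\<^sub>M gauss ?I" by measurable
  have S: "?S \<in> sets (gauss ?I)" by measurable
  have "{y \<in> space (gauss ?I). sign01 (p (?Z y)) = 0} = space (gauss ?I) - ?S" by (auto simp: sign01_def)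
  then have "measure (gauss ?I) {y \<in> space (gauss ?I). sign01 (p (?Z y)) = 0} = 1 - measure (gauss ?I) ?S"
    using I.prob_compl[OF S] by simp
  then have "1 - \<epsilon> < measure (gauss ?I) {y \<in> space (gauss ?I). sign01 (p (?Z y)) = 0} \<or> 1 - \<epsilon> < measure (gauss ?I) ?S"
    using \<epsilon> by linarith
  then show ?thesis unfolding std_gaussian_def by auto
qed

theorem theorem1p5:
  "\<exists>C::real. C > 0 \<and>
     (\<forall>(n::nat) (d::nat) (\<delta>::real) (\<epsilon>::real) (lam::real) (f::(nat \<Rightarrow> real) \<Rightarrow> real).
        \<delta> > 0 \<longrightarrow> \<epsilon> > 0 \<longrightarrow>
        polynomial_threshold_function n d f \<longrightarrow>
        0 < lam \<longrightarrow> lam < 1 \<longrightarrow>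
        lam \<le> C * (\<delta>\<^sup>2 / (real d ^ 6 * ln (1 / \<epsilon>))) \<longrightarrow>
        \<P>(x in std_gaussian n.
             \<exists>b\<in>{0, 1}. \<P>(y in std_gaussian n. gaussian_restriction n f x lam y = b) > 1 - \<epsilon>)
          \<ge> 1 - \<delta>)"
proof (intro exI[of _ "1 / 10 ^ 11"] conjI allI impI)
  fix n d :: nat and \<delta> \<epsilon> lam :: real and f :: "(nat \<Rightarrow> real) \<Rightarrow> real"
  assume \<delta>: "0 < \<delta>" and \<epsilon>: "0 < \<epsilon>" and f: "polynomial_threshold_function n d f"
    and lam: "0 < lam" "lam < 1" "lam \<le> 1 / 10 ^ 11 * (\<delta>\<^sup>2 / (real d ^ 6 * ln (1 / \<epsilon>)))"
  interpret G: prob_space "std_gaussian n" by (rule prob_space_std_gaussian)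
  obtain q where q: "polynomial_of_degree_le n d q" "\<forall>x\<in>Rn n. f x = sign01 (q x)"
    using f unfolding polynomial_threshold_function_def by blast
  obtain p where p: "poly_fun {..<n} d p" "\<forall>x\<in>Rn n. q x = p x"
    using polynomial_of_degree_le_poly_fun[OF q(1)] by blast
  let ?Z = "\<lambda>x y. \<lambda>i\<in>{..<n}. sqrt (1 - lam) * x i + sqrt lam * y i"
  let ?good = "\<lambda>x. \<exists>b\<in>{0, 1}. \<P>(y in std_gaussian n. gaussian_restriction n f x lam y = b) > 1 - \<epsilon>"
  have restr: "gaussian_restriction n f x lam y = sign01 (p (?Z x y))" for x y
  proof -
    have "?Z x y \<in> Rn n" by auto
    then show ?thesis using q(2) p(2) by (simp add: gaussian_restriction_def)
  qed
  \<comment> \<open>Division by zero gives 0, so at \<open>d = 0\<close> the upper bound on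
    \<open>lam\<close> contradicts \<open>0 < lam\<close>.\<close>
  have d: "d \<noteq> 0"
  proof
    assume "d = 0"
    then show False using lam(1,3) by simp
  qed
  have "\<exists>X \<in> sets (std_gaussian n). 1 - \<delta> \<le> measure (std_gaussian n) X \<and> (\<forall>x\<in>X. ?good x)"
  proof (cases "\<epsilon> \<le> 1 / 2")
    case True
    then show ?thesis
      using polynomial_restriction_concentrated[OF p(1) _ \<delta> \<epsilon> True lam] d unfolding restr by simp
  next
    case False
    then have "?good x" for x using sign_restriction_majority[OF p(1), of \<epsilon> lam x] unfolding restr by simp
    then show ?thesis using \<delta> by (intro bexI[of _ "space (std_gaussian n)"]) (auto simp: G.prob_space)
  qed
  then obtain X where X: "X \<in> sets (std_gaussian n)" "1 - \<delta> \<le> measure (std_gaussian n) X" "\<And>x. x \<in> X \<Longrightarrow> ?good x"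
    by blast
  \<comment> \<open>A nonmeasurable set has \<open>measure\<close> 0, so passing from
    \<open>X\<close> to the set of all good points requires the latter to be measurable; it is,
    because the measure of a section of a measurable set depends measurably on
    \<open>x\<close>.\<close>
  have "measure (std_gaussian n) X \<le> \<P>(x in std_gaussian n. ?good x)"
  proof (rule G.finite_measure_mono)
    show "X \<subseteq> {x \<in> space (std_gaussian n). ?good x}" using X sets.sets_into_space by blast
    let ?S = "\<lambda>b. {\<omega> \<in> space (std_gaussian n \<Otimes>\<^sub>M std_gaussian n). sign01 (p (?Z (fst \<omega>) (snd \<omega>))) = b}"
    note [measurable] = measurable_poly_fun[OF p(1)]
    have S: "?S b \<in> sets (std_gaussian n \<Otimes>\<^sub>M std_gaussian n)" for b
      unfolding std_gaussian_def by measurable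
    have eq: "\<P>(y in std_gaussian n. sign01 (p (?Z x y)) = b) = enn2real (emeasure (std_gaussian n) (Pair x -` ?S b))"
      if "x \<in> space (std_gaussian n)" for x b
      unfolding measure_def
      by (rule arg_cong[of _ _ "\<lambda>A. enn2real (emeasure (std_gaussian n) A)"])
        (use that in \<open>auto simp: space_pair_measure\<close>)
    have [measurable]: "(\<lambda>x. \<P>(y in std_gaussian n. sign01 (p (?Z x y)) = b)) \<in> borel_measurable (std_gaussian n)" for b
      using G.measurable_emeasure_Pair[OF S[of b]] by (subst measurable_cong[OF eq]) auto
    show "{x \<in> space (std_gaussian n). ?good x} \<in> sets (std_gaussian n)"
      unfolding restr by measurable
  qed
  with X(2) show "1 - \<delta> \<le> \<P>(x in std_gaussian n. ?good x)" by linarith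
qed simp

end
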